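(* Consider the Riemann problem for the inhomogeneous Lighthill-Whitham-Richards system $$a_t=0,\qquad \rho_t+f(a,\rho)_x=0,\qquad f(a,\rho)=\rho\,V(\rho/a),$$ for $U=(a,\rho)$, with data $U(x,0)=U_L=(a_L,\rho_L)$ for $x<0$ and $U(x,0)=U_R=(a_R,\rho_R)$ for $x>0$. Under the two entropy conditions described in the context, the solution exists and is unique, and it is of one of the following ten types (waves are listed from left to right). Suppose first that $U_L$ is undercritical ($\rho_L/a_L<\alpha$), and let $U_*=(a_*,\rho_* )$ be the critical state with $f(U_* )=f(U_L)$. 1. If $f(U_R)<f(U_* )=f(U_L)$, $\rho_R/a_R<\alpha$ and $a_R\ge a_*$: a standing wave $(U_L,U_1)$, then a rarefaction wave $(U_1,U_R)$ with characteristic velocity $\lambda_1>0$, where $U_1=(a_R,\rho_1)$ lies on the undercritical side and $f(U_1)=f(U_* )=f(U_L)$. 2. If $f(U_R)\ge f(U_* )=f(U_L)$: a standing wave $(U_L,U_1)$, then a shock wave $(U_1,U_R)$ with positive speed $\sigma=\frac{f(U_R)-f(U_* )}{\rho_R-\rho_1}>0$, where $U_1=(a_R,\rho_1)$ lies on the undercritical side and $f(U_1)=f(U_* )=f(U_L)$. 3. If $f(U_R)<f(U_* )=f(U_L)$ and $\rho_R/a_R\ge\alpha$: a shock wave $(U_L,U_1)$ with negative speed $\sigma=\frac{f(U_1)-f(U_L)}{\rho_1-\rho_L}<0$, then a standing wave $(U_1,U_R)$, where $U_1=(a_L,\rho_1)$ lies on the overcritical side and $f(U_1)=f(U_R)$.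 4. If $f(U_R)<f(U_* )=f(U_L)$, $\rho_R/a_R<\rho_*/a_*=\alpha$ and $a_R<a_*$: a shock wave $(U_L,U_1)$ with negative speed $\sigma=\frac{f(U_1)-f(U_L)}{\rho_1-\rho_L}<0$, a standing wave $(U_1,U_2)$, then a rarefaction wave $(U_2,U_R)$ with characteristic velocity $\lambda_1>0$, where $U_2=(a_R,\alpha a_R)$ and $U_1=(a_L,\rho_1)$ lies on the overcritical side with $f(U_1)=f(U_2)$. Suppose next that $U_L$ is overcritical ($\rho_L/a_L>\alpha$), and let $U_*=(a_*,\rho_* )=(a_L,\alpha a_L)$. 5. If $f(U_R)<f(U_* )$, $\rho_R/a_R<\alpha$ and $a_R\ge a_*=a_L$: a rarefaction wave $(U_L,U_* )$ with negative characteristic velocity, a standing wave $(U_*,U_2)$, then a rarefaction wave $(U_2,U_R)$ with positive characteristic velocity, where $U_2=(a_R,\rho_2)$ lies on the undercritical side and $f(U_2)=f(U_* )$. 6. If $f(U_R)\ge f(U_* )$: a rarefaction wave $(U_L,U_* )$ with negative characteristic velocity, a standing wave $(U_*,U_2)$, then a shock wave $(U_2,U_R)$ with positive speed $\sigma=\frac{f(U_R)-f(U_2)}{\rho_R-\rho_2}$, where $U_2=(a_R,\rho_2)$ lies on the undercritical side and $f(U_2)=f(U_* )$. 7. If $f(U_L)\le f(U_R)<f(U_* )$ and $\rho_R/a_R\ge\alpha$: a rarefaction wave $(U_L,U_1)$ with negative characteristic velocity, then a standing wave $(U_1,U_R)$, where $U_1=(a_L,\rho_1)$ lies on the overcritical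 side and $f(U_1)=f(U_R)$. 8. If $f(U_R)<f(U_L)<f(U_* )$ and $\rho_R/a_R\ge\alpha$: a shock wave $(U_L,U_1)$ with negative speed $\sigma=\frac{f(U_L)-f(U_1)}{\rho_L-\rho_1}$, then a standing wave $(U_1,U_R)$, where $U_1=(a_L,\rho_1)$ lies on the overcritical side and $f(U_1)=f(U_R)$. 9. If $f(U_L)\le f(U_R)<f(U_* )$, $\rho_R/a_R<\alpha$ and $a_R<a_*=a_L$: a rarefaction wave $(U_L,U_1)$ with negative characteristic velocity, a standing wave $(U_1,U_2)$, then a rarefaction wave $(U_2,U_R)$ with positive characteristic velocity, where $U_2=(a_R,\alpha a_R)$ and $U_1=(a_L,\rho_1)$ lies on the overcritical side with $f(U_1)=f(U_2)$. 10. If $f(U_R)<f(U_L)<f(U_* )$, $\rho_R/a_R<\alpha$ and $a_R<a_*=a_L$: a shock wave $(U_L,U_1)$ with negative speed, a standing wave $(U_1,U_2)$, then a rarefaction wave $(U_2,U_R)$ with positive characteristic velocity, where $U_2=(a_R,\alpha a_R)$ and $U_1=(a_L,\rho_1)$ lies on the overcritical side with $f(U_1)=f(U_2)$. Moreover, the average flux $f_0^*=\frac1{\Delta t}\int_0^{\Delta t} f(U(0,t))\,dt$ at the boundary $x=0$ is $f(U_L)$ for types 1, 2; $f(U_R)$ for types 3, 7, 8; $f_R^{\max}$ for types 4, 9, 10; and $f_L^{\max}$ for types 5, 6. If the upstream demand is defined by $f_L^*=f(U_L)$ when $\rho_L/a_L<\alpha$ and $f_L^*=f_L^{\max}$ when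 $\rho_L/a_L\ge\alpha$, and the downstream supply by $f_R^*=f_R^{\max}$ when $\rho_R/a_R<\alpha$ and $f_R^*=f(U_R)$ when $\rho_R/a_R\ge\alpha$, then $$f_0^*=\min\{f_L^*,f_R^*\},$$ and $f_L^*=f(U_* )$.
   Context: Here $\rho\ge0$ is traffic density, $a>0$ is an inhomogeneity factor (number of lanes), and $V$ is a smooth decreasing speed-density function on $[0,\rho_j]$ with $V(\rho_j)=0$ ($\rho_j$ = jam density per lane), such that $f(a,\rho)=\rho V(\rho/a)$ satisfies $f_{\rho\rho}<0$. The eigenvalues of the system are $\lambda_0=0$ and $\lambda_1(U)=V(\rho/a)+(\rho/a)V'(\rho/a)$. Let $\alpha$ be the unique solution of $V(\alpha)+\alpha V'(\alpha)=0$. A state is critical if $\rho/a=\alpha$ (equivalently $\lambda_1=0$), undercritical if $\rho/a<\alpha$, overcritical if $\rho/a>\alpha$. The transition curve is $\Gamma=\{(a,\rho):\rho/a=\alpha\}$; "on the undercritical (overcritical) side" means $\rho/a\le\alpha$ ($\rho/a\ge\alpha$). The capacities of the upstream and downstream roadways are $f_L^{\max}=\max_\rho f(a_L,\rho)=f(a_L,\alpha a_L)$ and $f_R^{\max}=\max_\rho f(a_R,\rho)=f(a_R,\alpha a_R)$. Elementary waves from a left state $U_-$ to a right state $U_+$: a standing wave is a stationary discontinuity at $x=0$ with $f(U_-)=f(U_+)$; a shock wave has $a_-=a_+$, $\rho_-<\rho_+$ and speed $\sigma=\frac{f(U_+)-f(U_-)}{\rho_+-\rho_-}$; a rarefaction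 wave has $a_-=a_+$, $\rho_->\rho_+$ and is a centered simple wave with characteristic velocity $\lambda_1$. Wave solutions of the Riemann problem are combinations of these elementary waves joining $U_L$ to $U_R$, subject to two entropy conditions: (Lax) the waves from left (upstream) to right (downstream) increase their wave speeds, so that they do not cross each other; (Isaacson-Temple) a standing wave cannot cross the transition curve $\Gamma$, i.e. its two states lie on the same side of $\Gamma$.
   Formalization: Type 10 also requires f_R^max<f(U_L); type 9 has f(U_L)≤f_R^max. In types 2, 6 σ=0 if f(U_R)=f(U_* ). Rarefactions may be critical at the edge facing the standing wave. At most one standing wave; zero-strength waves are dropped. *)

theory Defs
  imports "HOL-Analysis.Analysis"
begin

text \<open>A state is a pair (a, rho). Throughout, V is only meaningful on [0, rhoj], so all
derivatives are taken relative to the closed domain (one-sided at its end points).\<close>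

type_synonym state = "real \<times> real"

definition deriv_on :: "real set \<Rightarrow> (real \<Rightarrow> real) \<Rightarrow> real \<Rightarrow> real" where
  "deriv_on S g x = vector_derivative g (at x within S)"

definition smooth_fun_on :: "real set \<Rightarrow> (real \<Rightarrow> real) \<Rightarrow> bool" where
  "smooth_fun_on S g \<longleftrightarrow> (\<forall>k. \<forall>x\<in>S. (deriv_on S ^^ k) g differentiable (at x within S))"

definition is_state :: "real \<Rightarrow> state \<Rightarrow> bool" where
  "is_state rhoj U \<longleftrightarrow> 0 < fst U \<and> 0 \<le> snd U \<and> snd U \<le> fst U * rhoj"

definition flux :: "(real \<Rightarrow> real) \<Rightarrow> state \<Rightarrow> real" where
  "flux V U = snd U * V (snd U / fst U)"

definition flux_concave :: "(real \<Rightarrow> real) \<Rightarrow> real \<Rightarrow> bool" where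
  "flux_concave V rhoj \<longleftrightarrow>
     (\<forall>a>0. \<forall>\<rho>\<in>{0..a * rhoj}.
        deriv_on {0..a * rhoj} (deriv_on {0..a * rhoj} (\<lambda>r. flux V (a, r))) \<rho> < 0)"

definition lambda1 :: "(real \<Rightarrow> real) \<Rightarrow> real \<Rightarrow> state \<Rightarrow> real" where
  "lambda1 V rhoj U =
     V (snd U / fst U) + (snd U / fst U) * deriv_on {0..rhoj} V (snd U / fst U)"

definition alpha :: "(real \<Rightarrow> real) \<Rightarrow> real \<Rightarrow> real" where
  "alpha V rhoj = (THE r. r \<in> {0..rhoj} \<and> V r + r * deriv_on {0..rhoj} V r = 0)"

definition undercritical :: "(real \<Rightarrow> real) \<Rightarrow> real \<Rightarrow> state \<Rightarrow> bool" where
  "undercritical V rhoj U \<longleftrightarrow> snd U / fst U < alpha V rhoj"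

definition critical :: "(real \<Rightarrow> real) \<Rightarrow> real \<Rightarrow> state \<Rightarrow> bool" where
  "critical V rhoj U \<longleftrightarrow> snd U / fst U = alpha V rhoj"

definition overcritical :: "(real \<Rightarrow> real) \<Rightarrow> real \<Rightarrow> state \<Rightarrow> bool" where
  "overcritical V rhoj U \<longleftrightarrow> alpha V rhoj < snd U / fst U"

definition under_side :: "(real \<Rightarrow> real) \<Rightarrow> real \<Rightarrow> state \<Rightarrow> bool" where
  "under_side V rhoj U \<longleftrightarrow> snd U / fst U \<le> alpha V rhoj"

definition over_side :: "(real \<Rightarrow> real) \<Rightarrow> real \<Rightarrow> state \<Rightarrow> bool" where
  "over_side V rhoj U \<longleftrightarrow> alpha V rhoj \<le> snd U / fst U"

definition capacity :: "(real \<Rightarrow> real) \<Rightarrow> real \<Rightarrow> real \<Rightarrow> real" where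
  "capacity V rhoj a = (SUP \<rho>\<in>{0..a * rhoj}. flux V (a, \<rho>))"

text \<open>For undercritical data with positive density this is the critical state carrying the flux
of the left state. Writing criticality as rho = alpha a and allowing a = 0 covers the vacuum
state (rho = 0), whose flux 0 is carried by no critical state with a > 0; the result is then
(0, 0).\<close>

definition ustar :: "(real \<Rightarrow> real) \<Rightarrow> real \<Rightarrow> state \<Rightarrow> state" where
  "ustar V rhoj UL =
     (if undercritical V rhoj UL
      then (THE U. 0 \<le> fst U \<and> snd U = alpha V rhoj * fst U \<and> flux V U = flux V UL)
      else (fst UL, alpha V rhoj * fst UL))"

datatype wave =
    Standing (wleft: state) (wright: state)
  | Shock (wleft: state) (wright: state)
  | Rarefaction (wleft: state) (wright: state)

definition shock_speed :: "(real \<Rightarrow> real) \<Rightarrow> state \<Rightarrow> state \<Rightarrow> real" where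
  "shock_speed V U U' = (flux V U' - flux V U) / (snd U' - snd U)"

text \<open>Speeds of the left and of the right edge of a wave.\<close>

fun lspeed :: "(real \<Rightarrow> real) \<Rightarrow> real \<Rightarrow> wave \<Rightarrow> real" where
  "lspeed V rhoj (Standing U U') = 0"
| "lspeed V rhoj (Shock U U') = shock_speed V U U'"
| "lspeed V rhoj (Rarefaction U U') = lambda1 V rhoj U"

fun rspeed :: "(real \<Rightarrow> real) \<Rightarrow> real \<Rightarrow> wave \<Rightarrow> real" where
  "rspeed V rhoj (Standing U U') = 0"
| "rspeed V rhoj (Shock U U') = shock_speed V U U'"
| "rspeed V rhoj (Rarefaction U U') = lambda1 V rhoj U'"

fun elementary :: "(real \<Rightarrow> real) \<Rightarrow> wave \<Rightarrow> bool" where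
  "elementary V (Standing U U') \<longleftrightarrow> U \<noteq> U' \<and> flux V U = flux V U'"
| "elementary V (Shock U U') \<longleftrightarrow> fst U = fst U' \<and> snd U < snd U'"
| "elementary V (Rarefaction U U') \<longleftrightarrow> fst U = fst U' \<and> snd U' < snd U"

primrec joins :: "state \<Rightarrow> wave list \<Rightarrow> state \<Rightarrow> bool" where
  "joins U [] U' \<longleftrightarrow> U = U'"
| "joins U (w # ws) U' \<longleftrightarrow> wleft w = U \<and> joins (wright w) ws U'"

text \<open>Equality of neighbouring speeds must be allowed: a rarefaction ending in a critical state
is adjacent to the standing wave.\<close>

definition lax_entropy :: "(real \<Rightarrow> real) \<Rightarrow> real \<Rightarrow> wave list \<Rightarrow> bool" where
  "lax_entropy V rhoj ws \<longleftrightarrow> sorted_wrt (\<lambda>w w'. rspeed V rhoj w \<le> lspeed V rhoj w') ws"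

text \<open>The jump of a at x = 0 is a single standing wave. Without the bound on their number, two
consecutive standing waves meeting in a critical state would together cross the transition
curve.\<close>

definition isaacson_temple :: "(real \<Rightarrow> real) \<Rightarrow> real \<Rightarrow> wave list \<Rightarrow> bool" where
  "isaacson_temple V rhoj ws \<longleftrightarrow>
     length (filter is_Standing ws) \<le> 1 \<and>
     (\<forall>w\<in>set ws. is_Standing w \<longrightarrow>
        under_side V rhoj (wleft w) \<and> under_side V rhoj (wright w) \<or>
        over_side V rhoj (wleft w) \<and> over_side V rhoj (wright w))"

definition entropy_waves ::
    "(real \<Rightarrow> real) \<Rightarrow> real \<Rightarrow> state \<Rightarrow> state \<Rightarrow> wave list \<Rightarrow> bool" where
  "entropy_waves V rhoj UL UR ws \<longleftrightarrow>
     joins UL ws UR \<and>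
     (\<forall>w\<in>set ws. is_state rhoj (wleft w) \<and> is_state rhoj (wright w) \<and> elementary V w) \<and>
     lax_entropy V rhoj ws \<and> isaacson_temple V rhoj ws"

definition fan_state :: "(real \<Rightarrow> real) \<Rightarrow> real \<Rightarrow> state \<Rightarrow> real \<Rightarrow> state" where
  "fan_state V rhoj U \<xi> =
     (THE U'. is_state rhoj U' \<and> fst U' = fst U \<and> lambda1 V rhoj U' = \<xi>)"

text \<open>The self-similar function with the given waves, at x / t = \<open>\<xi>\<close>. It is normalised to be
left-continuous at jumps; in particular its value at x = 0 is the left trace. Since every
stationary jump preserves the flux, the flux at x = 0 does not depend on this choice.\<close>

primrec profile :: "(real \<Rightarrow> real) \<Rightarrow> real \<Rightarrow> state \<Rightarrow> wave list \<Rightarrow> real \<Rightarrow> state" where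
  "profile V rhoj U [] \<xi> = U"
| "profile V rhoj U (w # ws) \<xi> =
     (if \<xi> \<le> lspeed V rhoj w then U
      else if \<xi> \<le> rspeed V rhoj w then fan_state V rhoj U \<xi>
      else profile V rhoj (wright w) ws \<xi>)"

definition wave_solution ::
    "(real \<Rightarrow> real) \<Rightarrow> real \<Rightarrow> state \<Rightarrow> state \<Rightarrow> wave list \<Rightarrow> (real \<Rightarrow> real \<Rightarrow> state) \<Rightarrow> bool" where
  "wave_solution V rhoj UL UR ws W \<longleftrightarrow>
     entropy_waves V rhoj UL UR ws \<and>
     (\<forall>x<0. W x 0 = UL) \<and> (\<forall>x>0. W x 0 = UR) \<and>
     (\<forall>x. \<forall>t>0. W x t = profile V rhoj UL ws (x / t))"

definition riemann_solution ::
    "(real \<Rightarrow> real) \<Rightarrow> real \<Rightarrow> state \<Rightarrow> state \<Rightarrow> (real \<Rightarrow> real \<Rightarrow> state) \<Rightarrow> bool" where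
  "riemann_solution V rhoj UL UR W \<longleftrightarrow> (\<exists>ws. wave_solution V rhoj UL UR ws W)"

datatype rtype = Type1 | Type2 | Type3 | Type4 | Type5 | Type6 | Type7 | Type8 | Type9 | Type10

text \<open>In Types 9 and 10 the first wave leads to the overcritical state with flux
\<open>capacity V rhoj (fst UR)\<close>, so it is this number, and not the flux of UR, whose comparison with
the flux of UL decides between a rarefaction and a shock.\<close>

fun type_cond :: "(real \<Rightarrow> real) \<Rightarrow> real \<Rightarrow> rtype \<Rightarrow> state \<Rightarrow> state \<Rightarrow> bool" where
  "type_cond V rhoj Type1 UL UR \<longleftrightarrow> undercritical V rhoj UL \<and>
     flux V UR < flux V (ustar V rhoj UL) \<and> undercritical V rhoj UR \<and>
     fst (ustar V rhoj UL) \<le> fst UR"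
| "type_cond V rhoj Type2 UL UR \<longleftrightarrow> undercritical V rhoj UL \<and>
     flux V (ustar V rhoj UL) \<le> flux V UR"
| "type_cond V rhoj Type3 UL UR \<longleftrightarrow> undercritical V rhoj UL \<and>
     flux V UR < flux V (ustar V rhoj UL) \<and> over_side V rhoj UR"
| "type_cond V rhoj Type4 UL UR \<longleftrightarrow> undercritical V rhoj UL \<and>
     flux V UR < flux V (ustar V rhoj UL) \<and> undercritical V rhoj UR \<and>
     fst UR < fst (ustar V rhoj UL)"
| "type_cond V rhoj Type5 UL UR \<longleftrightarrow> overcritical V rhoj UL \<and>
     flux V UR < flux V (ustar V rhoj UL) \<and> undercritical V rhoj UR \<and>
     fst (ustar V rhoj UL) \<le> fst UR"
| "type_cond V rhoj Type6 UL UR \<longleftrightarrow> overcritical V rhoj UL \<and>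
     flux V (ustar V rhoj UL) \<le> flux V UR"
| "type_cond V rhoj Type7 UL UR \<longleftrightarrow> overcritical V rhoj UL \<and>
     flux V UL \<le> flux V UR \<and> flux V UR < flux V (ustar V rhoj UL) \<and> over_side V rhoj UR"
| "type_cond V rhoj Type8 UL UR \<longleftrightarrow> overcritical V rhoj UL \<and>
     flux V UR < flux V UL \<and> flux V UL < flux V (ustar V rhoj UL) \<and> over_side V rhoj UR"
| "type_cond V rhoj Type9 UL UR \<longleftrightarrow> overcritical V rhoj UL \<and>
     flux V UL \<le> capacity V rhoj (fst UR) \<and> flux V UR < flux V (ustar V rhoj UL) \<and>
     undercritical V rhoj UR \<and> fst UR < fst (ustar V rhoj UL)"
| "type_cond V rhoj Type10 UL UR \<longleftrightarrow> overcritical V rhoj UL \<and>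
     capacity V rhoj (fst UR) < flux V UL \<and>
     flux V UR < flux V UL \<and> flux V UL < flux V (ustar V rhoj UL) \<and>
     undercritical V rhoj UR \<and> fst UR < fst (ustar V rhoj UL)"

text \<open>Strict sign of the characteristic velocity throughout the wave, except at an edge facing
the standing wave, where the state may be critical.\<close>

definition pos_velocity :: "(real \<Rightarrow> real) \<Rightarrow> real \<Rightarrow> state \<Rightarrow> state \<Rightarrow> bool" where
  "pos_velocity V rhoj U U' \<longleftrightarrow>
     (\<forall>\<rho>. snd U' \<le> \<rho> \<and> \<rho> < snd U \<longrightarrow> 0 < lambda1 V rhoj (fst U, \<rho>))"

definition neg_velocity :: "(real \<Rightarrow> real) \<Rightarrow> real \<Rightarrow> state \<Rightarrow> state \<Rightarrow> bool" where
  "neg_velocity V rhoj U U' \<longleftrightarrow>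
     (\<forall>\<rho>. snd U' < \<rho> \<and> \<rho> \<le> snd U \<longrightarrow> lambda1 V rhoj (fst U, \<rho>) < 0)"

text \<open>The wave lists below may contain waves of zero strength (e.g. the standing wave if
\<open>fst UL = fst UR\<close>), which are no waves at all; see \<open>proper\<close>. In Types 2 and 6 the last wave has
speed 0 exactly in the limit case of equal fluxes.\<close>

fun type_waves ::
    "(real \<Rightarrow> real) \<Rightarrow> real \<Rightarrow> rtype \<Rightarrow> state \<Rightarrow> state \<Rightarrow> wave list \<Rightarrow> bool" where
  "type_waves V rhoj Type1 UL UR ws \<longleftrightarrow>
     (\<exists>\<rho>1. let U1 = (fst UR, \<rho>1) in
        ws = [Standing UL U1, Rarefaction U1 UR] \<and>
        is_state rhoj U1 \<and> under_side V rhoj U1 \<and>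
        flux V U1 = flux V (ustar V rhoj UL) \<and> flux V (ustar V rhoj UL) = flux V UL \<and>
        pos_velocity V rhoj U1 UR)"
| "type_waves V rhoj Type2 UL UR ws \<longleftrightarrow>
     (\<exists>\<rho>1. let U1 = (fst UR, \<rho>1) in
        ws = [Standing UL U1, Shock U1 UR] \<and>
        is_state rhoj U1 \<and> under_side V rhoj U1 \<and>
        flux V U1 = flux V (ustar V rhoj UL) \<and> flux V (ustar V rhoj UL) = flux V UL \<and>
        0 \<le> shock_speed V U1 UR \<and>
        (flux V UR \<noteq> flux V (ustar V rhoj UL) \<longrightarrow> 0 < shock_speed V U1 UR))"
| "type_waves V rhoj Type3 UL UR ws \<longleftrightarrow>
     (\<exists>\<rho>1. let U1 = (fst UL, \<rho>1) in
        ws = [Shock UL U1, Standing U1 UR] \<and>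
        is_state rhoj U1 \<and> over_side V rhoj U1 \<and> flux V U1 = flux V UR \<and>
        shock_speed V UL U1 < 0)"
| "type_waves V rhoj Type4 UL UR ws \<longleftrightarrow>
     (\<exists>\<rho>1. let U1 = (fst UL, \<rho>1); U2 = (fst UR, alpha V rhoj * fst UR) in
        ws = [Shock UL U1, Standing U1 U2, Rarefaction U2 UR] \<and>
        is_state rhoj U1 \<and> over_side V rhoj U1 \<and> flux V U1 = flux V U2 \<and>
        shock_speed V UL U1 < 0 \<and> pos_velocity V rhoj U2 UR)"
| "type_waves V rhoj Type5 UL UR ws \<longleftrightarrow>
     (\<exists>\<rho>2. let Us = ustar V rhoj UL; U2 = (fst UR, \<rho>2) in
        ws = [Rarefaction UL Us, Standing Us U2, Rarefaction U2 UR] \<and>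
        is_state rhoj U2 \<and> under_side V rhoj U2 \<and> flux V U2 = flux V Us \<and>
        neg_velocity V rhoj UL Us \<and> pos_velocity V rhoj U2 UR)"
| "type_waves V rhoj Type6 UL UR ws \<longleftrightarrow>
     (\<exists>\<rho>2. let Us = ustar V rhoj UL; U2 = (fst UR, \<rho>2) in
        ws = [Rarefaction UL Us, Standing Us U2, Shock U2 UR] \<and>
        is_state rhoj U2 \<and> under_side V rhoj U2 \<and> flux V U2 = flux V Us \<and>
        neg_velocity V rhoj UL Us \<and>
        0 \<le> shock_speed V U2 UR \<and>
        (flux V UR \<noteq> flux V Us \<longrightarrow> 0 < shock_speed V U2 UR))"
| "type_waves V rhoj Type7 UL UR ws \<longleftrightarrow>
     (\<exists>\<rho>1. let U1 = (fst UL, \<rho>1) in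
        ws = [Rarefaction UL U1, Standing U1 UR] \<and>
        is_state rhoj U1 \<and> over_side V rhoj U1 \<and> flux V U1 = flux V UR \<and>
        neg_velocity V rhoj UL U1)"
| "type_waves V rhoj Type8 UL UR ws \<longleftrightarrow>
     (\<exists>\<rho>1. let U1 = (fst UL, \<rho>1) in
        ws = [Shock UL U1, Standing U1 UR] \<and>
        is_state rhoj U1 \<and> over_side V rhoj U1 \<and> flux V U1 = flux V UR \<and>
        shock_speed V UL U1 < 0)"
| "type_waves V rhoj Type9 UL UR ws \<longleftrightarrow>
     (\<exists>\<rho>1. let U1 = (fst UL, \<rho>1); U2 = (fst UR, alpha V rhoj * fst UR) in
        ws = [Rarefaction UL U1, Standing U1 U2, Rarefaction U2 UR] \<and>
        is_state rhoj U1 \<and> over_side V rhoj U1 \<and> flux V U1 = flux V U2 \<and>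
        neg_velocity V rhoj UL U1 \<and> pos_velocity V rhoj U2 UR)"
| "type_waves V rhoj Type10 UL UR ws \<longleftrightarrow>
     (\<exists>\<rho>1. let U1 = (fst UL, \<rho>1); U2 = (fst UR, alpha V rhoj * fst UR) in
        ws = [Shock UL U1, Standing U1 U2, Rarefaction U2 UR] \<and>
        is_state rhoj U1 \<and> over_side V rhoj U1 \<and> flux V U1 = flux V U2 \<and>
        shock_speed V UL U1 < 0 \<and> pos_velocity V rhoj U2 UR)"

definition proper :: "wave list \<Rightarrow> wave list" where
  "proper ws = filter (\<lambda>w. wleft w \<noteq> wright w) ws"

fun type_flux :: "(real \<Rightarrow> real) \<Rightarrow> real \<Rightarrow> rtype \<Rightarrow> state \<Rightarrow> state \<Rightarrow> real" where
  "type_flux V rhoj Type1 UL UR = flux V UL"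
| "type_flux V rhoj Type2 UL UR = flux V UL"
| "type_flux V rhoj Type3 UL UR = flux V UR"
| "type_flux V rhoj Type4 UL UR = capacity V rhoj (fst UR)"
| "type_flux V rhoj Type5 UL UR = capacity V rhoj (fst UL)"
| "type_flux V rhoj Type6 UL UR = capacity V rhoj (fst UL)"
| "type_flux V rhoj Type7 UL UR = flux V UR"
| "type_flux V rhoj Type8 UL UR = flux V UR"
| "type_flux V rhoj Type9 UL UR = capacity V rhoj (fst UR)"
| "type_flux V rhoj Type10 UL UR = capacity V rhoj (fst UR)"

definition boundary_flux :: "(real \<Rightarrow> real) \<Rightarrow> (real \<Rightarrow> real \<Rightarrow> state) \<Rightarrow> real \<Rightarrow> real" where
  "boundary_flux V W dt = (1 / dt) * integral {0..dt} (\<lambda>t. flux V (W 0 t))"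

definition upstream_demand :: "(real \<Rightarrow> real) \<Rightarrow> real \<Rightarrow> state \<Rightarrow> real" where
  "upstream_demand V rhoj UL =
     (if undercritical V rhoj UL then flux V UL else capacity V rhoj (fst UL))"

definition downstream_supply :: "(real \<Rightarrow> real) \<Rightarrow> real \<Rightarrow> state \<Rightarrow> real" where
  "downstream_supply V rhoj UR =
     (if undercritical V rhoj UR then capacity V rhoj (fst UR) else flux V UR)"

end

theory Submission
  imports Defs
begin

text \<open>
  In terms of the density per lane \<open>r = rho / a\<close> the flux is \<open>a g(r)\<close> with the strictly concave
  function \<open>g(r) = r V(r)\<close>, which vanishes at both ends of \<open>[0, rhoj]\<close>. Hence \<open>\<lambda>\<^sub>1 = g'\<close> is strictly
  decreasing with exactly one zero \<open>\<alpha>\<close>, the flux increases on the undercritical and decreases on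
  the overcritical side, and on each side a state is determined by \<open>a\<close> and its flux.

  Uniqueness. Where \<open>a\<close> is constant, concavity puts the speed of a shock strictly between the
  characteristic velocities of its two states. So the Lax condition forbids a shock next to
  another shock or to a rarefaction, and a chain of such waves is a single shock or, up to
  subdivision, a single rarefaction (\<open>lane_chain_cases\<close>). A solution with a standing wave \<open>(U\<^sub>1, U\<^sub>2)\<close>
  therefore consists of one wave of nonpositive speed from \<open>U\<^sub>L\<close> to \<open>U\<^sub>1\<close> and one wave of nonnegative
  speed from \<open>U\<^sub>2\<close> to \<open>U\<^sub>R\<close> (\<open>entropy_structure\<close>). The first kind of wave can lower the flux below the
  upstream demand only by ending on the overcritical side; the second kind can have a flux below
  the downstream supply only by starting on the undercritical side. Since \<open>U\<^sub>1\<close> and \<open>U\<^sub>2\<close> carry the same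
  flux and lie on the same side, this flux must be the minimum of demand and supply
  (\<open>standing_flux\<close>). Once the flux at \<open>x = 0\<close> is known, the profiles on both sides of it are determined
  (\<open>upstream_unique\<close>, \<open>downstream_unique\<close>). The wave list itself is not unique: a rarefaction can be
  subdivided, and a shock of speed 0 may be placed on either side of the standing wave.

  Existence. For each of the ten types the intermediate states are found by inverting the flux on
  the required side of \<open>\<Gamma>\<close>, with waves of zero strength allowed and discarded afterwards
  (\<open>entropy_waves_proper\<close>, \<open>type_realized\<close>). By uniqueness every solution has the structure
  constructed for its type, and its boundary flux is the minimum of demand and supply, which in
  each type is the number claimed (\<open>type_flux_eq\<close>).
\<close>

section \<open>The flux per lane\<close>

lemma mvt_within:
  fixes f f' :: "real \<Rightarrow> real"
  assumes "x < y" "{x..y} \<subseteq> S"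
    and "\<And>r. r \<in> S \<Longrightarrow> (f has_real_derivative f' r) (at r within S)"
  obtains z where "x < z" "z < y" "f y - f x = f' z * (y - x)"
proof -
  have "(f has_derivative (*) (f' r)) (at r within {x..y})" if "x \<le> r" "r \<le> y" for r
  proof -
    have "r \<in> S" using that assms(2) by auto
    then have "(f has_real_derivative f' r) (at r within {x..y})"
      using assms(2,3) DERIV_subset by blast
    then show ?thesis by (simp add: has_field_derivative_def)
  qed
  then have "\<exists>z\<in>{x<..<y}. f y - f x = (*) (f' z) (y - x)"
    by (rule mvt_simple[OF assms(1)])
  then show ?thesis using that by auto
qed

locale lwr =
  fixes V :: "real \<Rightarrow> real" and rhoj :: real
  assumes rhoj_pos: "0 < rhoj"
    and V_smooth: "smooth_fun_on {0..rhoj} V"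
    and V_jam: "V rhoj = 0"
    and concave: "flux_concave V rhoj"
begin

definition g :: "real \<Rightarrow> real" where "g r = r * V r"

definition dg :: "real \<Rightarrow> real" where "dg r = V r + r * deriv_on {0..rhoj} V r"

abbreviation al :: real where "al \<equiv> alpha V rhoj"

lemma V_deriv:
  assumes "r \<in> {0..rhoj}"
  shows "(V has_real_derivative deriv_on {0..rhoj} V r) (at r within {0..rhoj})"
proof -
  have "V differentiable (at r within {0..rhoj})"
    using V_smooth assms unfolding smooth_fun_on_def by (metis funpow_0)
  then show ?thesis
    by (simp add: deriv_on_def has_real_derivative_iff_has_vector_derivative vector_derivative_works)
qed

lemma g_deriv:
  assumes "r \<in> {0..rhoj}"
  shows "(g has_real_derivative dg r) (at r within {0..rhoj})"
  unfolding g_def dg_def using assms by (auto intro!: derivative_eq_intros V_deriv)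

text \<open>The concavity assumption speaks of iterated one-sided derivatives of the flux; for \<open>a = 1\<close> these
are \<open>g\<close>, \<open>dg\<close> and the derivative of \<open>dg\<close>, whose existence comes from the smoothness of \<open>V\<close>.\<close>

lemma dg_deriv_neg:
  assumes "r \<in> {0..rhoj}"
  shows "\<exists>D<0. (dg has_real_derivative D) (at r within {0..rhoj})"
proof -
  let ?S = "{0..rhoj}"
  have S: "at x within ?S \<noteq> bot" if "x \<in> ?S" for x
    using that rhoj_pos by (simp add: trivial_limit_within islimpt_Icc)
  have dV: "(deriv_on ?S V has_real_derivative deriv_on ?S (deriv_on ?S V) r) (at r within ?S)"
  proof -
    have "(deriv_on ?S ^^ 1) V differentiable (at r within ?S)"
      using V_smooth assms unfolding smooth_fun_on_def by blast
    then show ?thesis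
      by (simp add: deriv_on_def has_real_derivative_iff_has_vector_derivative
          vector_derivative_works[symmetric])
  qed
  obtain D where D: "(dg has_real_derivative D) (at r within ?S)"
    using DERIV_add[OF V_deriv[OF assms] DERIV_mult[OF DERIV_ident dV]]
    unfolding dg_def by blast
  have dg: "deriv_on ?S g x = dg x" if "x \<in> ?S" for x
    using g_deriv[OF that] S[OF that] unfolding deriv_on_def
    by (simp add: has_real_derivative_iff_has_vector_derivative vector_derivative_within)
  have "(deriv_on ?S g has_vector_derivative D) (at r within ?S)"
    using D assms dg unfolding has_real_derivative_iff_has_vector_derivative
    by (rule_tac has_vector_derivative_transform[of r ?S _ dg]) auto
  then have eq: "deriv_on ?S (deriv_on ?S g) r = D"
    using S[OF assms] by (simp add: deriv_on_def[of _ "deriv_on ?S g"] vector_derivative_within)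
  have "(\<lambda>r. flux V (1, r)) = g"
    by (simp add: fun_eq_iff flux_def g_def)
  then have "deriv_on ?S (deriv_on ?S g) r < 0"
    using concave assms unfolding flux_concave_def by (metis mult_1 zero_less_one)
  then show ?thesis using D eq by blast
qed

lemma dg_strict:
  assumes "0 \<le> x" "x < y" "y \<le> rhoj"
  shows "dg y < dg x"
proof -
  have "\<forall>r\<in>{0..rhoj}. \<exists>D. D < 0 \<and> (dg has_real_derivative D) (at r within {0..rhoj})"
    using dg_deriv_neg by blast
  then obtain D where
    D: "\<forall>r\<in>{0..rhoj}. D r < 0 \<and> (dg has_real_derivative D r) (at r within {0..rhoj})"
    by (rule bchoice[THEN exE])
  then obtain z where "x < z" "z < y" "dg y - dg x = D z * (y - x)"
    using mvt_within[of x y "{0..rhoj}" dg D] assms by auto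
  then show ?thesis using D assms mult_neg_pos[of "D z" "y - x"] by auto
qed

lemma g_mvt:
  assumes "0 \<le> x" "x < y" "y \<le> rhoj"
  obtains z where "x < z" "z < y" "g y - g x = dg z * (y - x)"
  using mvt_within[of x y "{0..rhoj}" g dg] assms g_deriv by auto

text \<open>A zero of \<open>dg\<close> exists by Rolle's theorem, as \<open>g\<close> vanishes at \<open>0\<close> and, because \<open>V rhoj = 0\<close>, at the
jam density.\<close>

lemma alpha_props: "0 < al \<and> al < rhoj \<and> dg al = 0"
proof -
  obtain z where z: "0 < z" "z < rhoj" "g rhoj - g 0 = dg z * (rhoj - 0)"
    using g_mvt[of 0 rhoj] rhoj_pos by auto
  then have dz: "dg z = 0" using rhoj_pos by (simp add: g_def V_jam)
  have "al = z"
    unfolding alpha_def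
  proof (rule the_equality)
    show "z \<in> {0..rhoj} \<and> V z + z * deriv_on {0..rhoj} V z = 0" using z dz by (simp add: dg_def)
    fix r assume "r \<in> {0..rhoj} \<and> V r + r * deriv_on {0..rhoj} V r = 0"
    then have "r \<in> {0..rhoj}" "dg r = 0" by (simp_all add: dg_def)
    then show "r = z" using dg_strict[of r z] dg_strict[of z r] z dz by force
  qed
  then show ?thesis using z dz by simp
qed

lemma dg_pos_iff: "r \<in> {0..rhoj} \<Longrightarrow> 0 < dg r \<longleftrightarrow> r < al"
  and dg_neg_iff: "r \<in> {0..rhoj} \<Longrightarrow> dg r < 0 \<longleftrightarrow> al < r"
  using dg_strict[of r al] dg_strict[of al r] alpha_props
  by (cases r al rule: linorder_cases; force)+

lemma g_strict_under:
  assumes "0 \<le> x" "x < y" "y \<le> al"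
  shows "g x < g y"
proof -
  obtain z where "x < z" "z < y" "g y - g x = dg z * (y - x)"
    using g_mvt[of x y] assms alpha_props by auto
  then show ?thesis using dg_pos_iff[of z] assms alpha_props by (smt (verit) atLeastAtMost_iff mult_pos_pos)
qed

lemma g_strict_over:
  assumes "al \<le> x" "x < y" "y \<le> rhoj"
  shows "g y < g x"
proof -
  obtain z where "x < z" "z < y" "g y - g x = dg z * (y - x)"
    using g_mvt[of x y] assms alpha_props by auto
  then show ?thesis using dg_neg_iff[of z] assms alpha_props by (smt (verit) atLeastAtMost_iff mult_neg_pos)
qed

lemma g_less_max: "r \<in> {0..rhoj} \<Longrightarrow> r \<noteq> al \<Longrightarrow> g r < g al"
  using g_strict_under[of r al] g_strict_over[of al r] by fastforce

lemma g_max_pos: "0 < g al"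
  using g_strict_under[of 0 al] alpha_props by (simp add: g_def)

lemma g_nonneg: "r \<in> {0..rhoj} \<Longrightarrow> 0 \<le> g r"
  using g_strict_under[of 0 r] g_strict_over[of r rhoj]
  by (cases "r \<le> al"; cases "r = 0"; cases "r = rhoj") (auto simp: g_def V_jam)

lemma g_cont: "A \<subseteq> {0..rhoj} \<Longrightarrow> continuous_on A g"
  by (meson DERIV_continuous_on continuous_on_subset g_deriv)

lemma under_root:
  assumes "0 \<le> q" "q \<le> g al"
  obtains r where "0 \<le> r" "r \<le> al" "g r = q"
  using IVT'[of g 0 q al] assms alpha_props g_cont[of "{0..al}"] by (auto simp: g_def[of 0])

lemma over_root:
  assumes "0 \<le> q" "q \<le> g al"
  obtains r where "al \<le> r" "r \<le> rhoj" "g r = q"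
  using IVT2'[of g rhoj q al] assms alpha_props g_cont[of "{al..rhoj}"]
  by (auto simp: g_def[of rhoj] V_jam)

text \<open>The one quantitative use of concavity: shock speeds are chord slopes and characteristic
velocities are tangent slopes of \<open>g\<close>.\<close>

lemma g_chord:
  assumes "0 \<le> x" "x < y" "y \<le> rhoj"
  shows "dg y < (g y - g x) / (y - x)" "(g y - g x) / (y - x) < dg x"
proof -
  obtain z where "x < z" "z < y" "g y - g x = dg z * (y - x)"
    using g_mvt[of x y] assms by auto
  then show "dg y < (g y - g x) / (y - x)" "(g y - g x) / (y - x) < dg x"
    using dg_strict[of x z] dg_strict[of z y] assms by auto
qed

section \<open>States, sides and speeds\<close>

lemma state_ratio: "is_state rhoj U \<Longrightarrow> 0 < fst U \<and> snd U / fst U \<in> {0..rhoj}"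
  by (auto simp: is_state_def divide_le_eq mult.commute)

lemma state_of_ratio: "0 < a \<Longrightarrow> r \<in> {0..rhoj} \<Longrightarrow> is_state rhoj (a, a * r)"
  by (simp add: is_state_def)

lemma flux_ratio: "fst U \<noteq> 0 \<Longrightarrow> flux V U = fst U * g (snd U / fst U)"
  by (simp add: flux_def g_def)

lemma lambda_ratio: "lambda1 V rhoj U = dg (snd U / fst U)"
  by (simp add: lambda1_def dg_def)

lemma side_lambda:
  assumes "is_state rhoj U"
  shows "under_side V rhoj U \<longleftrightarrow> 0 \<le> lambda1 V rhoj U"
    and "over_side V rhoj U \<longleftrightarrow> lambda1 V rhoj U \<le> 0"
    and "undercritical V rhoj U \<longleftrightarrow> 0 < lambda1 V rhoj U"
    and "overcritical V rhoj U \<longleftrightarrow> lambda1 V rhoj U < 0"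
  using dg_pos_iff dg_neg_iff state_ratio[OF assms]
  unfolding under_side_def over_side_def undercritical_def overcritical_def lambda_ratio
  by (meson not_le)+

text \<open>The source of all restrictions by the Lax condition: a shock is faster than the characteristics
ahead of it and slower than those behind it.\<close>

lemma chord_speed:
  assumes "is_state rhoj U" "is_state rhoj U'" "fst U = fst U'" "snd U < snd U'"
  shows "lambda1 V rhoj U' < shock_speed V U U'" "shock_speed V U U' < lambda1 V rhoj U"
proof -
  let ?a = "fst U"
  have a: "0 < ?a" and r: "0 \<le> snd U / ?a" "snd U / ?a < snd U' / ?a" "snd U' / ?a \<le> rhoj"
    using state_ratio[OF assms(1)] state_ratio[OF assms(2)] assms(3,4)
    by (auto simp: divide_strict_right_mono)
  have "shock_speed V U U' = (?a * (g (snd U' / ?a) - g (snd U / ?a))) / (?a * (snd U' / ?a - snd U / ?a))"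
    using a assms(3) by (simp add: shock_speed_def flux_ratio right_diff_distrib)
  also have "\<dots> = (g (snd U' / ?a) - g (snd U / ?a)) / (snd U' / ?a - snd U / ?a)"
    using a by (subst mult_divide_mult_cancel_left) auto
  finally show "lambda1 V rhoj U' < shock_speed V U U'" "shock_speed V U U' < lambda1 V rhoj U"
    using g_chord[OF r] assms(3) by (simp_all add: lambda_ratio)
qed

lemma lambda_strict:
  assumes "is_state rhoj U" "is_state rhoj U'" "fst U = fst U'" "snd U < snd U'"
  shows "lambda1 V rhoj U' < lambda1 V rhoj U"
  using chord_speed[OF assms] by simp

lemma shock_speed_sign:
  assumes "snd U < snd U'"
  shows "shock_speed V U U' \<le> 0 \<longleftrightarrow> flux V U' \<le> flux V U"
    and "0 \<le> shock_speed V U U' \<longleftrightarrow> flux V U \<le> flux V U'"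
    and "shock_speed V U U' < 0 \<longleftrightarrow> flux V U' < flux V U"
    and "0 < shock_speed V U U' \<longleftrightarrow> flux V U < flux V U'"
  using assms
  by (auto simp: shock_speed_def divide_le_0_iff zero_le_divide_iff divide_less_0_iff zero_less_divide_iff)

lemma flux_mono_under:
  assumes "is_state rhoj U" "is_state rhoj U'" "fst U = fst U'" "snd U < snd U'" "under_side V rhoj U'"
  shows "flux V U < flux V U'"
  using chord_speed[OF assms(1-4)] assms(5) side_lambda[OF assms(2)]
    shock_speed_sign(4)[OF assms(4)] by simp

lemma flux_mono_over:
  assumes "is_state rhoj U" "is_state rhoj U'" "fst U = fst U'" "snd U < snd U'" "over_side V rhoj U"
  shows "flux V U' < flux V U"
  using chord_speed[OF assms(1-4)] assms(5) side_lambda[OF assms(1)]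
    shock_speed_sign(3)[OF assms(4)] by simp

lemma same_flux_same_side:
  assumes "is_state rhoj U" "is_state rhoj U'" "fst U = fst U'" "flux V U = flux V U'"
    and "under_side V rhoj U \<and> under_side V rhoj U' \<or> over_side V rhoj U \<and> over_side V rhoj U'"
  shows "U = U'"
proof (rule prod_eqI[OF assms(3)], rule ccontr)
  assume "snd U \<noteq> snd U'"
  then consider "snd U < snd U'" | "snd U' < snd U" by linarith
  then show False
    using flux_mono_under[of U U'] flux_mono_under[of U' U] flux_mono_over[of U U']
      flux_mono_over[of U' U] assms by cases auto
qed

lemma flux_nonneg: "is_state rhoj U \<Longrightarrow> 0 \<le> flux V U"
  using state_ratio[of U] g_nonneg[of "snd U / fst U"] by (simp add: flux_ratio)

lemma capacity_eq:
  assumes "0 < a"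
  shows "capacity V rhoj a = a * g al"
  unfolding capacity_def
proof (rule cSup_eq_maximum)
  have "flux V (a, a * al) = a * g al" using assms by (simp add: flux_ratio)
  then show "a * g al \<in> (\<lambda>\<rho>. flux V (a, \<rho>)) ` {0..a * rhoj}"
    using assms alpha_props by (metis (no_types, lifting) atLeastAtMost_iff image_eqI less_eq_real_def mult_left_mono zero_le_mult_iff)
  fix y assume "y \<in> (\<lambda>\<rho>. flux V (a, \<rho>)) ` {0..a * rhoj}"
  then obtain \<rho> where \<rho>: "\<rho> \<in> {0..a * rhoj}" "y = flux V (a, \<rho>)" by auto
  then have "\<rho> / a \<in> {0..rhoj}" using assms by (auto simp: divide_le_eq mult.commute)
  then have "g (\<rho> / a) \<le> g al" using g_less_max by fastforce
  then show "y \<le> a * g al" using assms \<rho> by (simp add: flux_ratio)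
qed

lemma flux_le_capacity:
  assumes "is_state rhoj U"
  shows "flux V U \<le> capacity V rhoj (fst U)"
    and "flux V U = capacity V rhoj (fst U) \<longleftrightarrow> critical V rhoj U"
proof -
  have U: "0 < fst U" "snd U / fst U \<in> {0..rhoj}" using state_ratio[OF assms] by auto
  then show "flux V U \<le> capacity V rhoj (fst U)"
    using g_less_max[of "snd U / fst U"] by (cases "snd U / fst U = al") (auto simp: capacity_eq flux_ratio)
  show "flux V U = capacity V rhoj (fst U) \<longleftrightarrow> critical V rhoj U"
    using U g_less_max[of "snd U / fst U"]
    by (cases "snd U / fst U = al") (auto simp: capacity_eq flux_ratio critical_def)
qed

lemma capacity_mono:
  "0 < a \<Longrightarrow> 0 < b \<Longrightarrow> capacity V rhoj a < capacity V rhoj b \<longleftrightarrow> a < b"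
  using g_max_pos by (simp add: capacity_eq)

lemma critical_state:
  assumes "0 < a"
  shows "is_state rhoj (a, al * a)" "under_side V rhoj (a, al * a)" "over_side V rhoj (a, al * a)"
    "flux V (a, al * a) = capacity V rhoj a" "lambda1 V rhoj (a, al * a) = 0"
  using assms alpha_props
  by (simp_all add: is_state_def under_side_def over_side_def flux_ratio capacity_eq lambda_ratio
      mult.commute[of a])

lemma under_state:
  assumes "0 < a" "0 \<le> q" "q \<le> capacity V rhoj a"
  obtains \<rho> where "is_state rhoj (a, \<rho>)" "under_side V rhoj (a, \<rho>)" "flux V (a, \<rho>) = q"
proof -
  obtain r where r: "0 \<le> r" "r \<le> al" "g r = q / a"
    using under_root[of "q / a"] assms by (auto simp: capacity_eq divide_le_eq mult.commute)
  show ?thesis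
    using r assms alpha_props state_of_ratio[of a r]
    by (intro that[of "a * r"]) (auto simp: under_side_def flux_ratio)
qed

lemma over_state:
  assumes "0 < a" "0 \<le> q" "q \<le> capacity V rhoj a"
  obtains \<rho> where "is_state rhoj (a, \<rho>)" "over_side V rhoj (a, \<rho>)" "flux V (a, \<rho>) = q"
proof -
  obtain r where r: "al \<le> r" "r \<le> rhoj" "g r = q / a"
    using over_root[of "q / a"] assms by (auto simp: capacity_eq divide_le_eq mult.commute)
  show ?thesis
    using r assms alpha_props state_of_ratio[of a r]
    by (intro that[of "a * r"]) (auto simp: over_side_def flux_ratio)
qed

lemma fan_state_lambda:
  assumes "is_state rhoj U'" "fst U' = fst U"
  shows "fan_state V rhoj U (lambda1 V rhoj U') = U'"
  unfolding fan_state_def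
proof (rule the_equality)
  fix U'' assume *: "is_state rhoj U'' \<and> fst U'' = fst U \<and> lambda1 V rhoj U'' = lambda1 V rhoj U'"
  then have "snd U'' = snd U'"
    using lambda_strict[of U' U''] lambda_strict[of U'' U'] assms by force
  then show "U'' = U'" using * assms by (simp add: prod_eq_iff)
qed (use assms in simp)

text \<open>Among the points \<open>(a, \<alpha> a)\<close> the flux is \<open>a g(\<alpha>)\<close>, also for \<open>a = 0\<close>, and hence takes each value once.
For vacuum data this yields \<open>a = 0\<close>.\<close>

lemma ustar_under:
  assumes "is_state rhoj U" "undercritical V rhoj U"
  shows "flux V (ustar V rhoj U) = flux V U" "fst (ustar V rhoj U) = flux V U / g al"
proof -
  let ?a = "flux V U / g al"
  have f: "flux V (b, al * b) = b * g al" for b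
    by (cases "b = 0", simp add: flux_def, simp add: flux_ratio)
  have "ustar V rhoj U = (?a, al * ?a)"
    unfolding ustar_def if_P[OF assms(2)]
  proof (rule the_equality)
    show "0 \<le> fst (?a, al * ?a) \<and> snd (?a, al * ?a) = al * fst (?a, al * ?a) \<and> flux V (?a, al * ?a) = flux V U"
      using f[of ?a] g_max_pos flux_nonneg[OF assms(1)] by simp
    fix U' assume "0 \<le> fst U' \<and> snd U' = al * fst U' \<and> flux V U' = flux V U"
    then have "snd U' = al * fst U'" "fst U' * g al = flux V U"
      using f[of "fst U'"] by (metis prod.collapse)+
    then show "U' = (?a, al * ?a)"
      using g_max_pos by (simp add: prod_eq_iff eq_divide_eq)
  qed
  then show "flux V (ustar V rhoj U) = flux V U" "fst (ustar V rhoj U) = ?a"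
    using f[of ?a] g_max_pos by simp_all
qed

end

section \<open>Chains of waves with a constant number of lanes\<close>

lemma joins_append: "joins U (xs @ ys) U' \<longleftrightarrow> (\<exists>U1. joins U xs U1 \<and> joins U1 ys U')"
  by (induction xs arbitrary: U) auto

context lwr
begin

text \<open>The solution of the Riemann problem with \<open>a\<close> constant. If \<open>U = U'\<close>, the branch for shocks applies, with
speed \<open>0 / 0 = 0\<close> and the same state on both sides.\<close>

definition lane_profile :: "state \<Rightarrow> state \<Rightarrow> real \<Rightarrow> state" where
  "lane_profile U U' \<xi> =
     (if snd U \<le> snd U' then (if \<xi> \<le> shock_speed V U U' then U else U')
      else if \<xi> \<le> lambda1 V rhoj U then U
      else if \<xi> \<le> lambda1 V rhoj U' then fan_state V rhoj U \<xi> else U')"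

definition lane_chain :: "state \<Rightarrow> wave list \<Rightarrow> state \<Rightarrow> bool" where
  "lane_chain U ws U' \<longleftrightarrow> joins U ws U' \<and>
     (\<forall>w\<in>set ws. is_state rhoj (wleft w) \<and> is_state rhoj (wright w) \<and> elementary V w
        \<and> \<not> is_Standing w) \<and>
     lax_entropy V rhoj ws"

text \<open>Behind a rarefaction or shock ending in \<open>U\<^sub>1\<close> a shock would have to be at least as fast as
\<open>\<lambda>\<^sub>1(U\<^sub>1)\<close>, whereas it is strictly slower; and a shock ending in \<open>U\<^sub>1\<close> is strictly faster than a
rarefaction starting there. So only rarefactions can follow each other, and their fans fit
together because a fan depends on its left state only through \<open>a\<close>.\<close>

lemma lane_chain_cases:
  assumes "lane_chain U ws U'" "is_state rhoj U'"
  shows "ws = [] \<and> U = U' \<or>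
    ws = [Shock U U'] \<and> fst U = fst U' \<and> snd U < snd U' \<or>
    ws \<noteq> [] \<and> fst U = fst U' \<and> snd U' < snd U \<and>
      lspeed V rhoj (hd ws) = lambda1 V rhoj U \<and> rspeed V rhoj (last ws) = lambda1 V rhoj U' \<and>
      (\<forall>\<xi>. profile V rhoj U ws \<xi> = lane_profile U U' \<xi>)"
  using assms(1)
proof (induction ws arbitrary: U)
  case Nil
  then show ?case by (simp add: lane_chain_def)
next
  case (Cons w ws)
  let ?U1 = "wright w"
  have w: "wleft w = U" "is_state rhoj U" "is_state rhoj ?U1" "elementary V w" "\<not> is_Standing w"
    and lax: "\<And>w'. w' \<in> set ws \<Longrightarrow> rspeed V rhoj w \<le> lspeed V rhoj w'"
    and ch: "lane_chain ?U1 ws U'"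
    using Cons.prems by (auto simp: lane_chain_def lax_entropy_def)
  note IH = Cons.IH[OF ch]
  \<comment> \<open>Whatever \<open>w\<close> is, its right edge is at least as fast as \<open>\<lambda>\<^sub>1(U\<^sub>1)\<close>, so no shock can follow.\<close>
  have first: "ws = [] \<and> ?U1 = U' \<or> ws \<noteq> [] \<and> fst ?U1 = fst U' \<and> snd U' < snd ?U1 \<and>
      rspeed V rhoj w \<le> lambda1 V rhoj ?U1 \<and>
      rspeed V rhoj (last ws) = lambda1 V rhoj U' \<and>
      (\<forall>\<xi>. profile V rhoj ?U1 ws \<xi> = lane_profile ?U1 U' \<xi>)"
  proof -
    have False if "ws = [Shock ?U1 U']" "fst ?U1 = fst U'" "snd ?U1 < snd U'"
    proof -
      have "rspeed V rhoj w < lambda1 V rhoj ?U1"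
        using lax[of "Shock ?U1 U'"] that chord_speed(2)[OF w(3) assms(2)] by simp
      moreover have "lambda1 V rhoj ?U1 \<le> rspeed V rhoj w"
        using w chord_speed(1)[of U ?U1] by (cases w) auto
      ultimately show False by simp
    qed
    then show ?thesis using IH lax[of "hd ws"] by force
  qed
  show ?case
  proof (cases w)
    case (Standing A B)
    with w show ?thesis by simp
  next
    case (Shock A B)
    then have "lambda1 V rhoj B < shock_speed V A B"
      using w chord_speed(1)[of A B] by auto
    then show ?thesis using first Shock w by auto
  next
    case (Rarefaction A B)
    then have wB: "w = Rarefaction U B" "fst U = fst B" "snd B < snd U" using w by auto
    have l: "lambda1 V rhoj U < lambda1 V rhoj B"
      using lambda_strict[of B U] wB w by simp
    consider "ws = []" "B = U'" | "ws \<noteq> []" "fst B = fst U'" "snd U' < snd B"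
        "rspeed V rhoj (last ws) = lambda1 V rhoj U'"
        "\<And>\<xi>. profile V rhoj B ws \<xi> = lane_profile B U' \<xi>"
      using first wB(1) by auto
    then show ?thesis
    proof cases
      case 1
      then show ?thesis using wB l by (simp add: lane_profile_def)
    next
      case 2
      have l': "lambda1 V rhoj B < lambda1 V rhoj U'"
        using lambda_strict[OF assms(2), of B] 2 w(3) wB(1) by simp
      have fan: "fan_state V rhoj U = fan_state V rhoj B"
        using wB by (simp add: fan_state_def fun_eq_iff)
      have "profile V rhoj U (w # ws) \<xi> = lane_profile U U' \<xi>" for \<xi>
        using 2 wB l l' by (simp add: lane_profile_def fan)
      then show ?thesis using 2 wB by (simp del: profile.simps)
    qed
  qed
qed

lemma lane_chain_profile:
  assumes "lane_chain U ws U'" "is_state rhoj U'"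
  shows "profile V rhoj U ws \<xi> = lane_profile U U' \<xi>"
proof -
  consider "ws = []" "U = U'" | "ws = [Shock U U']" "snd U < snd U'"
    | "profile V rhoj U ws \<xi> = lane_profile U U' \<xi>"
    using lane_chain_cases[OF assms] by blast
  then show ?thesis by cases (auto simp: lane_profile_def)
qed

lemma lane_chain_fst: "lane_chain U ws U' \<Longrightarrow> fst U = fst U'"
proof (induction ws arbitrary: U)
  case (Cons w ws)
  then show ?case by (cases w) (auto simp: lane_chain_def lax_entropy_def)
qed (simp add: lane_chain_def)

lemma lspeed_le_rspeed:
  "elementary V w \<Longrightarrow> is_state rhoj (wleft w) \<Longrightarrow> is_state rhoj (wright w) \<Longrightarrow>
    lspeed V rhoj w \<le> rspeed V rhoj w"
  using lambda_strict by (cases w) (auto simp: less_imp_le)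

section \<open>The flux at the boundary and uniqueness\<close>

text \<open>What a chain of waves with constant \<open>a\<close> and nonpositive speeds leaves of its two end states, and
below the same for nonnegative speeds.\<close>

definition upstream_link :: "state \<Rightarrow> state \<Rightarrow> bool" where
  "upstream_link U U1 \<longleftrightarrow> is_state rhoj U \<and> is_state rhoj U1 \<and> fst U = fst U1 \<and>
     (U1 = U \<or> snd U < snd U1 \<and> flux V U1 \<le> flux V U \<or> snd U1 < snd U \<and> lambda1 V rhoj U1 \<le> 0)"

definition downstream_link :: "state \<Rightarrow> state \<Rightarrow> bool" where
  "downstream_link U2 U \<longleftrightarrow> is_state rhoj U2 \<and> is_state rhoj U \<and> fst U2 = fst U \<and>
     (U2 = U \<or> snd U2 < snd U \<and> flux V U2 \<le> flux V U \<or> snd U < snd U2 \<and> 0 \<le> lambda1 V rhoj U2)"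

lemma chain_upstream_link:
  assumes "lane_chain U ws U1" "is_state rhoj U" "is_state rhoj U1"
    and "\<And>w. w \<in> set ws \<Longrightarrow> rspeed V rhoj w \<le> 0"
  shows "upstream_link U U1"
proof -
  have "ws \<noteq> [] \<Longrightarrow> rspeed V rhoj (last ws) \<le> 0" using assms(4) by simp
  with lane_chain_cases[OF assms(1,3)] assms(2,3) shock_speed_sign(1)[of U U1]
  show ?thesis by (auto simp: upstream_link_def)
qed

lemma chain_downstream_link:
  assumes "lane_chain U2 ws U" "is_state rhoj U2" "is_state rhoj U"
    and "\<And>w. w \<in> set ws \<Longrightarrow> 0 \<le> lspeed V rhoj w"
  shows "downstream_link U2 U"
proof -
  have "ws \<noteq> [] \<Longrightarrow> 0 \<le> lspeed V rhoj (hd ws)" using assms(4) by simp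
  with lane_chain_cases[OF assms(1,3)] assms(2,3) shock_speed_sign(2)[of U2 U]
  show ?thesis by (auto simp: downstream_link_def)
qed

lemma profile_downstream:
  assumes "\<And>w. w \<in> set pre \<Longrightarrow> lspeed V rhoj w \<le> 0 \<and> rspeed V rhoj w \<le> 0" "0 < \<xi>"
  shows "profile V rhoj U (pre @ Standing U1 U2 # post) \<xi> = profile V rhoj U2 post \<xi>"
  using assms(1)
proof (induction pre arbitrary: U)
  case (Cons w pre)
  then have "\<not> \<xi> \<le> lspeed V rhoj w" "\<not> \<xi> \<le> rspeed V rhoj w" using assms(2) by force+
  then show ?case using Cons by simp
qed (use assms(2) in simp)

lemma profile_upstream:
  assumes "joins U pre U1" "\<xi> \<le> 0"
  shows "profile V rhoj U (pre @ Standing U1 U2 # post) \<xi> = profile V rhoj U pre \<xi>"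
  using assms by (induction pre arbitrary: U) auto

text \<open>The standing wave has speed 0, so the Lax condition bounds the speeds to its left from above and
those to its right from below by 0. It must change \<open>a\<close>, since equal flux on one side of \<open>\<Gamma>\<close> with the
same \<open>a\<close> would make its two states equal; hence it occurs exactly if \<open>a\<^sub>L \<noteq> a\<^sub>R\<close>.\<close>

lemma entropy_structure:
  assumes "entropy_waves V rhoj UL UR ws" "is_state rhoj UL" "is_state rhoj UR"
  shows "fst UL = fst UR \<and> (\<forall>\<xi>. profile V rhoj UL ws \<xi> = lane_profile UL UR \<xi>) \<or>
    fst UL \<noteq> fst UR \<and> (\<exists>U1 U2. upstream_link UL U1 \<and> downstream_link U2 UR \<and> flux V U1 = flux V U2 \<and>
      (under_side V rhoj U1 \<and> under_side V rhoj U2 \<or> over_side V rhoj U1 \<and> over_side V rhoj U2) \<and>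
      (\<forall>\<xi>. profile V rhoj UL ws \<xi> =
        (if \<xi> \<le> 0 then lane_profile UL U1 \<xi> else lane_profile U2 UR \<xi>)))"
proof (cases "\<exists>w\<in>set ws. is_Standing w")
  case False
  then have "lane_chain UL ws UR" using assms(1) by (auto simp: entropy_waves_def lane_chain_def)
  then show ?thesis using lane_chain_profile[OF _ assms(3)] lane_chain_fst by blast
next
  case True
  then obtain w pre post where ws: "ws = pre @ w # post" "is_Standing w" by (meson split_list)
  obtain U1 U2 where w: "w = Standing U1 U2" using ws(2) by (cases w) auto
  have "length (filter is_Standing ws) \<le> 1" and lax: "lax_entropy V rhoj ws" and
    el: "\<And>w. w \<in> set ws \<Longrightarrow> is_state rhoj (wleft w) \<and> is_state rhoj (wright w) \<and> elementary V w" and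
    side: "under_side V rhoj U1 \<and> under_side V rhoj U2 \<or> over_side V rhoj U1 \<and> over_side V rhoj U2" and
    j: "joins UL ws UR"
    using assms(1) w ws by (auto simp: entropy_waves_def isaacson_temple_def)
  then have ns: "\<not> is_Standing w'" if "w' \<in> set pre \<or> w' \<in> set post" for w'
    using ws that by (auto simp: filter_empty_conv)
  have j1: "joins UL pre U1" and j2: "joins U2 post UR" using j w ws by (auto simp: joins_append)
  have st: "is_state rhoj U1" "is_state rhoj U2" "U1 \<noteq> U2" "flux V U1 = flux V U2"
    using el[of w] w ws by auto
  have c1: "lane_chain UL pre U1"
    using j1 el ns lax ws by (auto simp: lane_chain_def lax_entropy_def sorted_wrt_append)
  have c2: "lane_chain U2 post UR"
    using j2 el ns lax ws by (auto simp: lane_chain_def lax_entropy_def sorted_wrt_append)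
  have r: "rspeed V rhoj w' \<le> 0" if "w' \<in> set pre" for w'
    using lax ws w that by (auto simp: lax_entropy_def sorted_wrt_append)
  have r': "lspeed V rhoj w' \<le> 0 \<and> rspeed V rhoj w' \<le> 0" if "w' \<in> set pre" for w'
    using lspeed_le_rspeed[of w'] el[of w'] ws r[OF that] that by force
  have l: "0 \<le> lspeed V rhoj w'" if "w' \<in> set post" for w'
    using lax ws w that by (auto simp: lax_entropy_def sorted_wrt_append)
  have "fst U1 \<noteq> fst U2" using same_flux_same_side st side by blast
  then have "fst UL \<noteq> fst UR" using lane_chain_fst c1 c2 by metis
  moreover have "profile V rhoj UL ws \<xi> =
      (if \<xi> \<le> 0 then lane_profile UL U1 \<xi> else lane_profile U2 UR \<xi>)" for \<xi>
    using profile_downstream[OF r', of pre] profile_upstream[OF j1]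
      lane_chain_profile[OF c1 st(1)] lane_chain_profile[OF c2 assms(3)] unfolding ws w by simp
  ultimately show ?thesis
    using chain_upstream_link[OF c1 assms(2) st(1) r] chain_downstream_link[OF c2 st(2) assms(3) l]
      side st by blast
qed

text \<open>An undercritical state emits backwards only shocks, which cross to the overcritical side and
do not raise the flux; an overcritical state reaches every overcritical state, up to capacity.\<close>

lemma upstream_link_demand:
  assumes "upstream_link U U1"
  shows "flux V U1 \<le> upstream_demand V rhoj U"
    and "over_side V rhoj U1 \<or> U1 = U \<and> flux V U1 = upstream_demand V rhoj U"
proof -
  have st: "is_state rhoj U" "is_state rhoj U1" "fst U = fst U1"
    and c: "U1 = U \<or> snd U < snd U1 \<and> flux V U1 \<le> flux V U \<or> snd U1 < snd U \<and> lambda1 V rhoj U1 \<le> 0"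
    using assms by (auto simp: upstream_link_def)
  show "flux V U1 \<le> upstream_demand V rhoj U"
    using c st flux_le_capacity(1)[of U1] side_lambda(3)[of U] lambda_strict[of U1 U]
    by (auto simp: upstream_demand_def)
  show "over_side V rhoj U1 \<or> U1 = U \<and> flux V U1 = upstream_demand V rhoj U"
    using c st side_lambda[of U1] flux_mono_under[of U U1]
    by (auto simp: upstream_demand_def)
qed

text \<open>Mirror image of the previous lemma: an overcritical state is reached by forward waves only through
a shock from the undercritical side.\<close>

lemma downstream_link_supply:
  assumes "downstream_link U2 U"
  shows "flux V U2 \<le> downstream_supply V rhoj U"
    and "under_side V rhoj U2 \<or> U2 = U \<and> flux V U2 = downstream_supply V rhoj U"
proof -
  have st: "is_state rhoj U" "is_state rhoj U2" "fst U2 = fst U"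
    and c: "U2 = U \<or> snd U2 < snd U \<and> flux V U2 \<le> flux V U \<or> snd U < snd U2 \<and> 0 \<le> lambda1 V rhoj U2"
    using assms by (auto simp: downstream_link_def)
  show "flux V U2 \<le> downstream_supply V rhoj U"
    using c st flux_le_capacity(1)[of U2] side_lambda(3)[of U] lambda_strict[of U U2]
    by (auto simp: downstream_supply_def)
  show "under_side V rhoj U2 \<or> U2 = U \<and> flux V U2 = downstream_supply V rhoj U"
    using c st side_lambda[of U2] flux_mono_over[of U2 U]
    by (auto simp: downstream_supply_def)
qed

lemma demand_le: "is_state rhoj U \<Longrightarrow> upstream_demand V rhoj U \<le> capacity V rhoj (fst U)"
  and supply_le: "is_state rhoj U \<Longrightarrow> downstream_supply V rhoj U \<le> capacity V rhoj (fst U)"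
  using flux_le_capacity(1)[of U] by (simp_all add: upstream_demand_def downstream_supply_def)

lemma both_sides_critical:
  "under_side V rhoj U \<Longrightarrow> over_side V rhoj U \<Longrightarrow> is_state rhoj U \<Longrightarrow> flux V U = capacity V rhoj (fst U)"
  using flux_le_capacity(2)[of U] by (simp add: under_side_def over_side_def critical_def)

text \<open>If the two states are on the overcritical side, the right one either is \<open>U\<^sub>R\<close>, with the supply as its
flux, or also lies on the undercritical side; then it is critical and its flux, the capacity, is
at least the supply. Likewise the undercritical side forces the demand. As the flux exceeds
neither, it is their minimum.\<close>

lemma standing_flux:
  assumes "upstream_link UL U1" "downstream_link U2 UR" "flux V U1 = flux V U2"
    and "under_side V rhoj U1 \<and> under_side V rhoj U2 \<or> over_side V rhoj U1 \<and> over_side V rhoj U2"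
  shows "flux V U1 = min (upstream_demand V rhoj UL) (downstream_supply V rhoj UR)"
proof -
  have "is_state rhoj UL" "is_state rhoj U1" "fst UL = fst U1"
       "is_state rhoj UR" "is_state rhoj U2" "fst U2 = fst UR"
    using assms(1,2) by (auto simp: upstream_link_def downstream_link_def)
  then show ?thesis
  using upstream_link_demand[OF assms(1)] downstream_link_supply[OF assms(2)] assms(3,4)
    demand_le[of UL] supply_le[of UR] both_sides_critical[of U1] both_sides_critical[of U2]
  by (smt (verit, ccfv_threshold))
qed

text \<open>The state \<open>U\<^sub>1\<close> may be ambiguous if the flux is that of an undercritical \<open>U\<close>: it is \<open>U\<close> itself or the
end of a shock of speed 0. Both look the same for \<open>\<xi> \<le> 0\<close>.\<close>

lemma upstream_unique:
  assumes "upstream_link U U1" "upstream_link U U1'" "flux V U1 = flux V U1'" "\<xi> \<le> 0"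
  shows "lane_profile U U1 \<xi> = lane_profile U U1' \<xi>"
proof -
  have st: "is_state rhoj U" "is_state rhoj U1" "fst U1 = fst U" "is_state rhoj U1'" "fst U1' = fst U"
    using assms(1,2) by (auto simp: upstream_link_def)
  \<comment> \<open>Speed-0 shocks are invisible here because profiles are left-continuous.\<close>
  have stay: "lane_profile U W \<xi> = U"
    if "upstream_link U W" "\<not> over_side V rhoj U" "flux V W = flux V U" for W
  proof -
    have "snd U \<le> snd W"
      using that st side_lambda(2)[of U] lambda_strict[of W U] by (auto simp: upstream_link_def)
    then show ?thesis
      using that(3) assms(4) by (simp add: lane_profile_def shock_speed_def)
  qed
  show ?thesis
  proof (cases "over_side V rhoj U1 \<and> over_side V rhoj U1'")
    case True
    then show ?thesis using same_flux_same_side[of U1 U1'] st assms(3) by simp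
  next
    case False
    then have "\<not> over_side V rhoj U" "flux V U1 = flux V U"
      using upstream_link_demand(2)[OF assms(1)] upstream_link_demand(2)[OF assms(2)] assms(3) by auto
    then show ?thesis using stay[OF assms(1)] stay[OF assms(2)] assms(3) by simp
  qed
qed

lemma downstream_unique:
  assumes "downstream_link U2 U" "downstream_link U2' U" "flux V U2 = flux V U2'" "0 < \<xi>"
  shows "lane_profile U2 U \<xi> = lane_profile U2' U \<xi>"
proof -
  have st: "is_state rhoj U" "is_state rhoj U2" "fst U2 = fst U" "is_state rhoj U2'" "fst U2' = fst U"
    using assms(1,2) by (auto simp: downstream_link_def)
  have arrived: "lane_profile W U \<xi> = U"
    if "downstream_link W U" "\<not> under_side V rhoj U" "flux V W = flux V U" for W
  proof -
    have "snd W \<le> snd U"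
      using that st side_lambda(1)[of U] lambda_strict[of U W] by (auto simp: downstream_link_def)
    then show ?thesis
      using that(3) assms(4) by (simp add: lane_profile_def shock_speed_def)
  qed
  show ?thesis
  proof (cases "under_side V rhoj U2 \<and> under_side V rhoj U2'")
    case True
    then show ?thesis using same_flux_same_side[of U2 U2'] st assms(3) by simp
  next
    case False
    then have "\<not> under_side V rhoj U" "flux V U2 = flux V U"
      using downstream_link_supply(2)[OF assms(1)] downstream_link_supply(2)[OF assms(2)] assms(3) by auto
    then show ?thesis using arrived[OF assms(1)] arrived[OF assms(2)] assms(3) by simp
  qed
qed

lemma profile_unique:
  assumes "entropy_waves V rhoj UL UR ws" "entropy_waves V rhoj UL UR ws'"
    "is_state rhoj UL" "is_state rhoj UR"
  shows "profile V rhoj UL ws \<xi> = profile V rhoj UL ws' \<xi>"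
proof (cases "fst UL = fst UR")
  case True
  then show ?thesis
    using entropy_structure[OF assms(1,3,4)] entropy_structure[OF assms(2-4)] by simp
next
  case False
  obtain U1 U2 where 1: "upstream_link UL U1" "downstream_link U2 UR" "flux V U1 = flux V U2"
    "under_side V rhoj U1 \<and> under_side V rhoj U2 \<or> over_side V rhoj U1 \<and> over_side V rhoj U2"
    "profile V rhoj UL ws \<xi> = (if \<xi> \<le> 0 then lane_profile UL U1 \<xi> else lane_profile U2 UR \<xi>)"
    using entropy_structure[OF assms(1,3,4)] False by blast
  obtain U1' U2' where 2: "upstream_link UL U1'" "downstream_link U2' UR" "flux V U1' = flux V U2'"
    "under_side V rhoj U1' \<and> under_side V rhoj U2' \<or> over_side V rhoj U1' \<and> over_side V rhoj U2'"
    "profile V rhoj UL ws' \<xi> = (if \<xi> \<le> 0 then lane_profile UL U1' \<xi> else lane_profile U2' UR \<xi>)"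
    using entropy_structure[OF assms(2-4)] False by blast
  have "flux V U1 = flux V U1'" "flux V U2 = flux V U2'"
    using standing_flux[OF 1(1-4)] standing_flux[OF 2(1-4)] 1(3) 2(3) by auto
  then show ?thesis
    using 1(5) 2(5) upstream_unique[OF 1(1) 2(1)] downstream_unique[OF 1(2) 2(2)] by simp
qed

lemma upstream_trace_flux:
  assumes "upstream_link U U1"
  shows "flux V (lane_profile U U1 0) = flux V U1"
proof -
  have st: "is_state rhoj U" "is_state rhoj U1" "fst U = fst U1"
    using assms by (auto simp: upstream_link_def)
  show ?thesis
    using assms st shock_speed_sign[of U U1] lambda_strict[of U1 U] fan_state_lambda[of U1 U]
    by (auto simp: upstream_link_def lane_profile_def)
qed

text \<open>For constant \<open>a\<close> there is no standing wave to argue with, but the value at \<open>\<xi> = 0\<close> is explicit: one of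
the data, or the critical state inside a transonic rarefaction.\<close>

lemma homogeneous_trace_flux:
  assumes "is_state rhoj UL" "is_state rhoj UR" "fst UL = fst UR"
  shows "flux V (lane_profile UL UR 0) = min (upstream_demand V rhoj UL) (downstream_supply V rhoj UR)"
proof (cases "snd UL \<le> snd UR")
  case True
  have "flux V (lane_profile UL UR 0) = min (flux V UL) (flux V UR)"
  proof (cases "snd UL = snd UR")
    case True
    then have "UL = UR" using assms by (simp add: prod_eq_iff)
    then show ?thesis by (simp add: lane_profile_def)
  next
    case False
    then show ?thesis using True shock_speed_sign(2)[of UL UR] by (auto simp: lane_profile_def)
  qed
  also have "\<dots> = min (upstream_demand V rhoj UL) (downstream_supply V rhoj UR)"
  proof (cases "snd UL = snd UR")
    case True
    then have "UL = UR" using assms by (simp add: prod_eq_iff)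
    then show ?thesis using flux_le_capacity(1)[OF assms(2)]
      by (auto simp: upstream_demand_def downstream_supply_def)
  next
    case False
    then have "snd UL < snd UR" using True by simp
    then show ?thesis
      using assms flux_mono_under[of UL UR] flux_mono_over[of UL UR] lambda_strict[of UL UR]
        side_lambda[of UL] side_lambda[of UR] flux_le_capacity(1)[of UL] flux_le_capacity(1)[of UR]
      by (auto simp: upstream_demand_def downstream_supply_def)
  qed
  finally show ?thesis .
next
  case False
  let ?C = "(fst UL, al * fst UL)"
  have a: "0 < fst UL" using state_ratio[OF assms(1)] by simp
  have C: "fan_state V rhoj UL 0 = ?C" "flux V ?C = capacity V rhoj (fst UL)"
    using fan_state_lambda[of ?C UL] critical_state[OF a] by simp_all
  have l: "lambda1 V rhoj UL < lambda1 V rhoj UR" using lambda_strict[of UR UL] assms False by simp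
  have cap: "lambda1 V rhoj U = 0 \<Longrightarrow> is_state rhoj U \<Longrightarrow> flux V U = capacity V rhoj (fst U)" for U
    using both_sides_critical[of U] side_lambda[of U] by simp
  show ?thesis
    using False l C cap[of UL] cap[of UR] assms side_lambda(3)[of UL] side_lambda(3)[of UR]
      flux_le_capacity(1)[of UL] flux_le_capacity(1)[of UR]
    by (auto simp: lane_profile_def upstream_demand_def downstream_supply_def)
qed

lemma trace_flux:
  assumes "entropy_waves V rhoj UL UR ws" "is_state rhoj UL" "is_state rhoj UR"
  shows "flux V (profile V rhoj UL ws 0) = min (upstream_demand V rhoj UL) (downstream_supply V rhoj UR)"
  using entropy_structure[OF assms]
proof (elim disjE conjE exE)
  assume "fst UL = fst UR" "\<forall>\<xi>. profile V rhoj UL ws \<xi> = lane_profile UL UR \<xi>"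
  then show ?thesis using homogeneous_trace_flux assms by simp
next
  fix U1 U2 assume "upstream_link UL U1" "downstream_link U2 UR" "flux V U1 = flux V U2"
    and side: "under_side V rhoj U1" "under_side V rhoj U2"
    and "\<forall>\<xi>. profile V rhoj UL ws \<xi> =
        (if \<xi> \<le> 0 then lane_profile UL U1 \<xi> else lane_profile U2 UR \<xi>)"
  then show ?thesis using standing_flux upstream_trace_flux by simp
next
  fix U1 U2 assume "upstream_link UL U1" "downstream_link U2 UR" "flux V U1 = flux V U2"
    and side: "over_side V rhoj U1" "over_side V rhoj U2"
    and "\<forall>\<xi>. profile V rhoj UL ws \<xi> =
        (if \<xi> \<le> 0 then lane_profile UL U1 \<xi> else lane_profile U2 UR \<xi>)"
  then show ?thesis using standing_flux upstream_trace_flux by simp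
qed

end

section \<open>Construction of the ten types\<close>

text \<open>The ten types list waves that may have zero strength; these satisfy the conditions below, with
non-strict inequalities, and can be dropped without disturbing the chain or the order of speeds.\<close>

fun weakly_elementary :: "(real \<Rightarrow> real) \<Rightarrow> wave \<Rightarrow> bool" where
  "weakly_elementary V (Standing U U') \<longleftrightarrow> flux V U = flux V U'"
| "weakly_elementary V (Shock U U') \<longleftrightarrow> fst U = fst U' \<and> snd U \<le> snd U'"
| "weakly_elementary V (Rarefaction U U') \<longleftrightarrow> fst U = fst U' \<and> snd U' \<le> snd U"

lemma weakly_elementary_proper:
  "weakly_elementary V w \<Longrightarrow> wleft w \<noteq> wright w \<Longrightarrow> elementary V w"
  by (cases w) (auto simp: prod_eq_iff)

lemma joins_proper: "joins U ws U' \<Longrightarrow> joins U (proper ws) U'"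
  by (induction ws arbitrary: U) (auto simp: proper_def)

lemma entropy_waves_proper:
  assumes "joins UL ws UR" "lax_entropy V rhoj ws" "isaacson_temple V rhoj ws"
    and "\<And>w. w \<in> set ws \<Longrightarrow>
      is_state rhoj (wleft w) \<and> is_state rhoj (wright w) \<and> weakly_elementary V w"
  shows "entropy_waves V rhoj UL UR (proper ws)"
proof -
  have "length (filter is_Standing (proper ws)) \<le> length (filter is_Standing ws)"
    unfolding proper_def by (induction ws) auto
  then show ?thesis
    using assms joins_proper[OF assms(1)] weakly_elementary_proper
    by (auto simp: entropy_waves_def lax_entropy_def isaacson_temple_def sorted_wrt_filter proper_def)
qed

context lwr
begin

text \<open>The next four lemmas supply the outer waves of the ten types. The comparison of fluxes on the side
of \<open>\<Gamma>\<close> of the intermediate state decides between a rarefaction and a shock.\<close>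

lemma slow_rarefaction:
  assumes "is_state rhoj U" "is_state rhoj U1" "fst U1 = fst U"
    and "over_side V rhoj U" "over_side V rhoj U1" "flux V U \<le> flux V U1"
  shows "snd U1 \<le> snd U" "neg_velocity V rhoj U U1" "lambda1 V rhoj U1 \<le> 0"
proof -
  show "snd U1 \<le> snd U" using flux_mono_over[of U U1] assms by force
  show "lambda1 V rhoj U1 \<le> 0" using side_lambda(2) assms by blast
  show "neg_velocity V rhoj U U1"
    unfolding neg_velocity_def
  proof (intro allI impI)
    fix \<rho> assume r: "snd U1 < \<rho> \<and> \<rho> \<le> snd U"
    then have "is_state rhoj (fst U, \<rho>)" using assms(1,2) by (auto simp: is_state_def)
    then show "lambda1 V rhoj (fst U, \<rho>) < 0"
      using lambda_strict[of U1 "(fst U, \<rho>)"] r assms \<open>lambda1 V rhoj U1 \<le> 0\<close> by simp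
  qed
qed

lemma fast_rarefaction:
  assumes "is_state rhoj U2" "is_state rhoj U" "fst U2 = fst U"
    and "under_side V rhoj U2" "under_side V rhoj U" "flux V U \<le> flux V U2"
  shows "snd U \<le> snd U2" "pos_velocity V rhoj U2 U" "0 \<le> lambda1 V rhoj U2"
proof -
  show "snd U \<le> snd U2" using flux_mono_under[of U2 U] assms by force
  show "0 \<le> lambda1 V rhoj U2" using side_lambda(1) assms by blast
  show "pos_velocity V rhoj U2 U"
    unfolding pos_velocity_def
  proof (intro allI impI)
    fix \<rho> assume r: "snd U \<le> \<rho> \<and> \<rho> < snd U2"
    then have "is_state rhoj (fst U2, \<rho>)" using assms(1,2) by (auto simp: is_state_def)
    then show "0 < lambda1 V rhoj (fst U2, \<rho>)"
      using lambda_strict[of "(fst U2, \<rho>)" U2] r assms \<open>0 \<le> lambda1 V rhoj U2\<close> by simp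
  qed
qed

lemma slow_shock:
  assumes "is_state rhoj U" "is_state rhoj U1" "fst U1 = fst U"
    and "over_side V rhoj U1" "flux V U1 < flux V U"
  shows "snd U < snd U1" "shock_speed V U U1 < 0"
proof -
  show *: "snd U < snd U1"
    using flux_mono_over[of U1 U] assms prod_eqI[of U U1] by (cases "snd U" "snd U1" rule: linorder_cases) auto
  then show "shock_speed V U U1 < 0" using shock_speed_sign(3) assms by blast
qed

lemma fast_shock:
  assumes "is_state rhoj U2" "is_state rhoj U" "fst U2 = fst U"
    and "under_side V rhoj U2" "flux V U2 \<le> flux V U"
  shows "snd U2 \<le> snd U" "0 \<le> shock_speed V U2 U"
    "flux V U \<noteq> flux V U2 \<Longrightarrow> 0 < shock_speed V U2 U"
proof -
  show le: "snd U2 \<le> snd U"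
    using flux_mono_under[of U U2] assms by force
  show "0 \<le> shock_speed V U2 U"
    using assms(5) le by (simp add: shock_speed_def)
  assume "flux V U \<noteq> flux V U2"
  moreover from this have "snd U2 < snd U" using le assms(3) by (metis order_le_less prod_eqI)
  ultimately show "0 < shock_speed V U2 U" using assms(5) shock_speed_sign(4) by simp
qed

definition realizes :: "rtype \<Rightarrow> state \<Rightarrow> state \<Rightarrow> bool" where
  "realizes T UL UR \<longleftrightarrow>
     (\<exists>ws. type_waves V rhoj T UL UR ws \<and> entropy_waves V rhoj UL UR (proper ws))"

lemma strict_side:
  "undercritical V rhoj U \<Longrightarrow> under_side V rhoj U" "overcritical V rhoj U \<Longrightarrow> over_side V rhoj U"
  "over_side V rhoj U \<longleftrightarrow> \<not> undercritical V rhoj U"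
  by (auto simp: undercritical_def overcritical_def under_side_def over_side_def)

lemma ustar_over: "over_side V rhoj U \<Longrightarrow> ustar V rhoj U = (fst U, al * fst U)"
  by (simp add: ustar_def strict_side)

context
  fixes UL UR :: state
  assumes UL: "is_state rhoj UL" and UR: "is_state rhoj UR"
begin

lemma a_pos: "0 < fst UL" "0 < fst UR"
  using UL UR by (auto simp: is_state_def)

lemma realizes_type1:
  assumes "undercritical V rhoj UL" "flux V UR < flux V UL" "undercritical V rhoj UR"
    "flux V UL \<le> capacity V rhoj (fst UR)"
  shows "realizes Type1 UL UR"
proof -
  obtain \<rho> where U1: "is_state rhoj (fst UR, \<rho>)" "under_side V rhoj (fst UR, \<rho>)"
    "flux V (fst UR, \<rho>) = flux V UL"
    using under_state[of "fst UR" "flux V UL"] a_pos flux_nonneg[OF UL] assms by blast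
  let ?U1 = "(fst UR, \<rho>)"
  note r = fast_rarefaction[OF U1(1) UR _ U1(2)]
  have "entropy_waves V rhoj UL UR (proper [Standing UL ?U1, Rarefaction ?U1 UR])"
    using U1 r assms UL UR
    by (intro entropy_waves_proper) (auto simp: lax_entropy_def isaacson_temple_def strict_side)
  then show ?thesis
    using U1 r assms ustar_under[OF UL] by (auto simp: realizes_def Let_def strict_side)
qed

lemma realizes_type2:
  assumes "undercritical V rhoj UL" "flux V UL \<le> flux V UR"
  shows "realizes Type2 UL UR"
proof -
  obtain \<rho> where U1: "is_state rhoj (fst UR, \<rho>)" "under_side V rhoj (fst UR, \<rho>)"
    "flux V (fst UR, \<rho>) = flux V UL"
    using under_state[of "fst UR" "flux V UL"] a_pos flux_nonneg[OF UL] assms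
      flux_le_capacity(1)[OF UR] by force
  let ?U1 = "(fst UR, \<rho>)"
  note r = fast_shock[OF U1(1) UR _ U1(2)]
  have "entropy_waves V rhoj UL UR (proper [Standing UL ?U1, Shock ?U1 UR])"
    using U1 r assms UL UR
    by (intro entropy_waves_proper) (auto simp: lax_entropy_def isaacson_temple_def strict_side)
  then show ?thesis
    using U1 r assms ustar_under[OF UL] by (auto simp: realizes_def Let_def)
qed

text \<open>Types 3 and 8 prescribe the same waves, as do Types 4 and 10: a shock towards lower flux exists
from either side of \<open>\<Gamma>\<close>.\<close>

lemma realizes_types_3_8:
  assumes "flux V UR < flux V UL" "over_side V rhoj UR"
  shows "realizes Type3 UL UR" "realizes Type8 UL UR"
proof -
  obtain \<rho> where U1: "is_state rhoj (fst UL, \<rho>)" "over_side V rhoj (fst UL, \<rho>)"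
    "flux V (fst UL, \<rho>) = flux V UR"
    using over_state[of "fst UL" "flux V UR"] a_pos flux_nonneg[OF UR] assms
      flux_le_capacity(1)[OF UL] by force
  let ?U1 = "(fst UL, \<rho>)"
  note r = slow_shock[OF UL U1(1) _ U1(2)]
  have "entropy_waves V rhoj UL UR (proper [Shock UL ?U1, Standing ?U1 UR])"
    using U1 r assms UL UR
    by (intro entropy_waves_proper) (auto simp: lax_entropy_def isaacson_temple_def less_imp_le)
  then show "realizes Type3 UL UR" "realizes Type8 UL UR"
    using U1 r assms by (auto simp: realizes_def Let_def)
qed

lemma realizes_types_4_10:
  assumes "capacity V rhoj (fst UR) < flux V UL" "undercritical V rhoj UR"
  shows "realizes Type4 UL UR" "realizes Type10 UL UR"
proof -
  let ?U2 = "(fst UR, al * fst UR)"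
  note U2 = critical_state[OF a_pos(2)]
  have le: "flux V UR \<le> capacity V rhoj (fst UR)" using flux_le_capacity(1)[OF UR] .
  obtain \<rho> where U1: "is_state rhoj (fst UL, \<rho>)" "over_side V rhoj (fst UL, \<rho>)"
    "flux V (fst UL, \<rho>) = capacity V rhoj (fst UR)"
    using over_state[of "fst UL" "capacity V rhoj (fst UR)"] a_pos flux_nonneg[OF UR] assms
      flux_le_capacity(1)[OF UL] le by force
  let ?U1 = "(fst UL, \<rho>)"
  note r = slow_shock[OF UL U1(1) _ U1(2)] fast_rarefaction[OF U2(1) UR _ U2(2)]
  have "entropy_waves V rhoj UL UR (proper [Shock UL ?U1, Standing ?U1 ?U2, Rarefaction ?U2 UR])"
    using U1 U2 r assms UL UR le
    by (intro entropy_waves_proper)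
      (auto simp: lax_entropy_def isaacson_temple_def less_imp_le strict_side)
  then show "realizes Type4 UL UR" "realizes Type10 UL UR"
    using U1 U2 r assms le by (auto simp: realizes_def Let_def strict_side)
qed

lemma realizes_type5:
  assumes "over_side V rhoj UL" "flux V UR \<le> capacity V rhoj (fst UL)" "undercritical V rhoj UR"
    "fst UL \<le> fst UR"
  shows "realizes Type5 UL UR"
proof -
  let ?Us = "(fst UL, al * fst UL)"
  note Us = critical_state[OF a_pos(1)]
  have le: "flux V UL \<le> capacity V rhoj (fst UL)" using flux_le_capacity(1)[OF UL] .
  have "capacity V rhoj (fst UL) \<le> capacity V rhoj (fst UR)"
    using capacity_mono[OF a_pos(2,1)] assms(4) by linarith
  then obtain \<rho> where U2: "is_state rhoj (fst UR, \<rho>)" "under_side V rhoj (fst UR, \<rho>)"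
    "flux V (fst UR, \<rho>) = capacity V rhoj (fst UL)"
    using under_state[of "fst UR" "capacity V rhoj (fst UL)"] a_pos flux_nonneg[OF UL] le by force
  let ?U2 = "(fst UR, \<rho>)"
  note r = slow_rarefaction[OF UL Us(1) _ assms(1) Us(3)] fast_rarefaction[OF U2(1) UR _ U2(2)]
  have "entropy_waves V rhoj UL UR (proper [Rarefaction UL ?Us, Standing ?Us ?U2, Rarefaction ?U2 UR])"
    using U2 Us r assms UL UR le
    by (intro entropy_waves_proper)
      (auto simp: lax_entropy_def isaacson_temple_def less_imp_le strict_side)
  then show ?thesis
    using U2 Us r assms le ustar_over by (auto simp: realizes_def Let_def strict_side)
qed

lemma realizes_type6:
  assumes "over_side V rhoj UL" "capacity V rhoj (fst UL) \<le> flux V UR"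
  shows "realizes Type6 UL UR"
proof -
  let ?Us = "(fst UL, al * fst UL)"
  note Us = critical_state[OF a_pos(1)]
  have le: "flux V UL \<le> capacity V rhoj (fst UL)" using flux_le_capacity(1)[OF UL] .
  have "capacity V rhoj (fst UL) \<le> capacity V rhoj (fst UR)"
    using assms(2) flux_le_capacity(1)[OF UR] by linarith
  then obtain \<rho> where U2: "is_state rhoj (fst UR, \<rho>)" "under_side V rhoj (fst UR, \<rho>)"
    "flux V (fst UR, \<rho>) = capacity V rhoj (fst UL)"
    using under_state[of "fst UR" "capacity V rhoj (fst UL)"] a_pos flux_nonneg[OF UL] le by force
  let ?U2 = "(fst UR, \<rho>)"
  note r = slow_rarefaction[OF UL Us(1) _ assms(1) Us(3)] fast_shock[OF U2(1) UR _ U2(2)]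
  have "entropy_waves V rhoj UL UR (proper [Rarefaction UL ?Us, Standing ?Us ?U2, Shock ?U2 UR])"
    using U2 Us r assms UL UR le
    by (intro entropy_waves_proper)
      (auto simp: lax_entropy_def isaacson_temple_def less_imp_le strict_side)
  then show ?thesis
    using U2 Us r assms le ustar_over by (auto simp: realizes_def Let_def)
qed

lemma realizes_type7:
  assumes "over_side V rhoj UL" "flux V UL \<le> flux V UR" "flux V UR \<le> capacity V rhoj (fst UL)"
    "over_side V rhoj UR"
  shows "realizes Type7 UL UR"
proof -
  obtain \<rho> where U1: "is_state rhoj (fst UL, \<rho>)" "over_side V rhoj (fst UL, \<rho>)"
    "flux V (fst UL, \<rho>) = flux V UR"
    using over_state[of "fst UL" "flux V UR"] a_pos flux_nonneg[OF UR] assms by blast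
  let ?U1 = "(fst UL, \<rho>)"
  note r = slow_rarefaction[OF UL U1(1) _ assms(1) U1(2)]
  have "entropy_waves V rhoj UL UR (proper [Rarefaction UL ?U1, Standing ?U1 UR])"
    using U1 r assms UL UR
    by (intro entropy_waves_proper) (auto simp: lax_entropy_def isaacson_temple_def)
  then show ?thesis
    using U1 r assms by (auto simp: realizes_def Let_def)
qed

lemma realizes_type9:
  assumes "over_side V rhoj UL" "flux V UL \<le> capacity V rhoj (fst UR)" "undercritical V rhoj UR"
    "fst UR < fst UL"
  shows "realizes Type9 UL UR"
proof -
  let ?U2 = "(fst UR, al * fst UR)"
  note U2 = critical_state[OF a_pos(2)]
  have le: "flux V UR \<le> capacity V rhoj (fst UR)" using flux_le_capacity(1)[OF UR] .
  have "capacity V rhoj (fst UR) \<le> capacity V rhoj (fst UL)"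
    using capacity_mono[OF a_pos(2,1)] assms(4) by linarith
  then obtain \<rho> where U1: "is_state rhoj (fst UL, \<rho>)" "over_side V rhoj (fst UL, \<rho>)"
    "flux V (fst UL, \<rho>) = capacity V rhoj (fst UR)"
    using over_state[of "fst UL" "capacity V rhoj (fst UR)"] a_pos flux_nonneg[OF UR] le by force
  let ?U1 = "(fst UL, \<rho>)"
  note r = slow_rarefaction[OF UL U1(1) _ assms(1) U1(2)] fast_rarefaction[OF U2(1) UR _ U2(2)]
  have "entropy_waves V rhoj UL UR (proper [Rarefaction UL ?U1, Standing ?U1 ?U2, Rarefaction ?U2 UR])"
    using U1 U2 r assms UL UR le
    by (intro entropy_waves_proper)
      (auto simp: lax_entropy_def isaacson_temple_def less_imp_le strict_side)
  then show ?thesis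
    using U1 U2 r assms le by (auto simp: realizes_def Let_def strict_side)
qed

lemma ustar_flux: "flux V (ustar V rhoj UL) = upstream_demand V rhoj UL"
  using ustar_under[OF UL] ustar_over[of UL] critical_state(4)[OF a_pos(1)]
  by (simp add: upstream_demand_def strict_side)

lemma ustar_fst_le:
  "undercritical V rhoj UL \<Longrightarrow> fst (ustar V rhoj UL) \<le> fst UR \<longleftrightarrow> flux V UL \<le> capacity V rhoj (fst UR)"
  using ustar_under(2)[OF UL] capacity_eq[OF a_pos(2)] g_max_pos by (simp add: divide_le_eq)

lemma type_realized:
  assumes "type_cond V rhoj T UL UR"
  shows "realizes T UL UR"
proof -
  have D: "undercritical V rhoj UL \<Longrightarrow> flux V (ustar V rhoj UL) = flux V UL"
    "overcritical V rhoj UL \<Longrightarrow> flux V (ustar V rhoj UL) = capacity V rhoj (fst UL)"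
    "overcritical V rhoj UL \<Longrightarrow> fst (ustar V rhoj UL) = fst UL"
    using ustar_flux ustar_over by (auto simp: upstream_demand_def strict_side
        overcritical_def undercritical_def ustar_def)
  show ?thesis
    using assms D ustar_fst_le strict_side(1,2)[of UL]
    by (cases T) (auto intro: realizes_type1 realizes_type2 realizes_types_3_8 realizes_types_4_10 realizes_type5 realizes_type6
        realizes_type7 realizes_type9)
qed

lemma type_flux_eq:
  assumes "type_cond V rhoj T UL UR"
  shows "type_flux V rhoj T UL UR = min (upstream_demand V rhoj UL) (downstream_supply V rhoj UR)"
proof -
  have D: "undercritical V rhoj UL \<Longrightarrow> flux V (ustar V rhoj UL) = flux V UL"
    "overcritical V rhoj UL \<Longrightarrow> flux V (ustar V rhoj UL) = capacity V rhoj (fst UL)"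
    "overcritical V rhoj UL \<Longrightarrow> fst (ustar V rhoj UL) = fst UL"
    "overcritical V rhoj UL \<Longrightarrow> \<not> undercritical V rhoj UL"
    using ustar_flux ustar_over by (auto simp: upstream_demand_def strict_side
        overcritical_def undercritical_def ustar_def)
  show ?thesis
    using assms D ustar_fst_le flux_le_capacity(1)[OF UR] capacity_mono[OF a_pos] capacity_mono[OF a_pos(2,1)]
    by (cases T) (auto simp: upstream_demand_def downstream_supply_def strict_side(3) min_def
        split: if_splits)
qed

lemma type_unique:
  assumes "\<not> critical V rhoj UL"
  shows "\<exists>!T. type_cond V rhoj T UL UR"
proof -
  consider "undercritical V rhoj UL" "\<not> overcritical V rhoj UL"
    | "overcritical V rhoj UL" "\<not> undercritical V rhoj UL"
    using assms unfolding critical_def undercritical_def overcritical_def by linarith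
  then show ?thesis
  proof cases
    case 1
    consider "type_cond V rhoj Type1 UL UR" | "type_cond V rhoj Type2 UL UR"
      | "type_cond V rhoj Type3 UL UR" | "type_cond V rhoj Type4 UL UR"
      using 1 by (simp add: strict_side(3)) (meson not_le)
    then show ?thesis
      by cases (rule ex1I, assumption,
          (rename_tac T, case_tac T; use 1 in \<open>auto simp: strict_side(3)\<close>))+
  next
    case 2
    then have "flux V UL \<noteq> capacity V rhoj (fst UL)"
      using flux_le_capacity(2)[OF UL] assms by simp
    then have *: "flux V UL < flux V (ustar V rhoj UL)"
      using ustar_flux flux_le_capacity(1)[OF UL] 2 by (simp add: upstream_demand_def)
    have **: "flux V UR \<le> capacity V rhoj (fst UR)" using flux_le_capacity(1)[OF UR] .
    consider "type_cond V rhoj Type5 UL UR" | "type_cond V rhoj Type6 UL UR"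
      | "type_cond V rhoj Type7 UL UR" | "type_cond V rhoj Type8 UL UR"
      | "type_cond V rhoj Type9 UL UR" | "type_cond V rhoj Type10 UL UR"
      using 2 * ** by (simp add: strict_side(3)) (meson not_le le_less_trans)
    then show ?thesis
      by cases (rule ex1I, assumption,
          (rename_tac T, case_tac T; use 2 in \<open>auto simp: strict_side(3)\<close>))+
  qed
qed

text \<open>Critical \<open>U\<^sub>L\<close> belongs to none of the types, but the constructions for overcritical \<open>U\<^sub>L\<close> still work
when its side is only required in the weak sense.\<close>

lemma entropy_waves_exist: "\<exists>ws. entropy_waves V rhoj UL UR ws"
proof (cases "undercritical V rhoj UL")
  case True
  then have "\<exists>T. realizes T UL UR"
    using realizes_type1 realizes_type2 realizes_types_3_8(1) realizes_types_4_10(1) strict_side(3)[of UR]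
    by (meson not_le)
  then show ?thesis by (auto simp: realizes_def)
next
  case False
  then have "over_side V rhoj UL" by (simp add: strict_side)
  then have "\<exists>T. realizes T UL UR"
    using realizes_type5 realizes_type6 realizes_type7 realizes_types_3_8(2) realizes_type9 realizes_types_4_10(2) strict_side(3)[of UR]
    by (meson not_le less_imp_le)
  then show ?thesis by (auto simp: realizes_def)
qed

text \<open>By self-similarity \<open>W 0 t\<close> is constant for \<open>t > 0\<close>; the time \<open>t = 0\<close>, where it is
unspecified, is a null set.\<close>

lemma boundary_flux_eq:
  assumes "riemann_solution V rhoj UL UR W" "0 < dt"
  shows "(\<lambda>t. flux V (W 0 t)) integrable_on {0..dt}"
    and "boundary_flux V W dt = min (upstream_demand V rhoj UL) (downstream_supply V rhoj UR)"
proof -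
  let ?q = "min (upstream_demand V rhoj UL) (downstream_supply V rhoj UR)"
  obtain ws where ws: "entropy_waves V rhoj UL UR ws"
    "\<forall>x. \<forall>t>0. W x t = profile V rhoj UL ws (x / t)"
    using assms(1) unfolding riemann_solution_def wave_solution_def by blast
  have "flux V (W 0 t) = ?q" if "t \<in> {0..dt} - {0}" for t
    using that ws(2) trace_flux[OF ws(1) UL UR] by simp
  moreover have "((\<lambda>t. ?q) has_integral dt * ?q) {0..dt}"
    using has_integral_const_real[of ?q 0 dt] assms(2) by simp
  ultimately have *: "((\<lambda>t. flux V (W 0 t)) has_integral dt * ?q) {0..dt}"
    by (rule has_integral_spike_finite[of "{0}", rotated 1]) auto
  then show "(\<lambda>t. flux V (W 0 t)) integrable_on {0..dt}" by blast
  show "boundary_flux V W dt = ?q"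
    using integral_unique[OF *] assms(2) by (simp add: boundary_flux_def)
qed

end

end

section \<open>The Riemann problem\<close>

theorem mainTheorem1:
  fixes V :: "real \<Rightarrow> real" and rhoj :: real and UL UR :: state
  assumes "0 < rhoj"
    and "smooth_fun_on {0..rhoj} V"
    and "antimono_on {0..rhoj} V"
    and "V rhoj = 0"
    and "flux_concave V rhoj"
    and "is_state rhoj UL" and "is_state rhoj UR"
  shows "(\<exists>W. riemann_solution V rhoj UL UR W) \<and>
    (\<forall>W W'. riemann_solution V rhoj UL UR W \<and> riemann_solution V rhoj UL UR W' \<longrightarrow>
       (\<forall>x. \<forall>t>0. W x t = W' x t)) \<and>
    (\<not> critical V rhoj UL \<longrightarrow> (\<exists>!T. type_cond V rhoj T UL UR)) \<and>
    (\<forall>W T. riemann_solution V rhoj UL UR W \<and> type_cond V rhoj T UL UR \<longrightarrow>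
       (\<exists>ws. type_waves V rhoj T UL UR ws \<and> wave_solution V rhoj UL UR (proper ws) W)) \<and>
    (\<forall>W dt. riemann_solution V rhoj UL UR W \<and> 0 < dt \<longrightarrow>
       (\<lambda>t. flux V (W 0 t)) integrable_on {0..dt} \<and>
       (\<forall>T. type_cond V rhoj T UL UR \<longrightarrow> boundary_flux V W dt = type_flux V rhoj T UL UR) \<and>
       boundary_flux V W dt = min (upstream_demand V rhoj UL) (downstream_supply V rhoj UR)) \<and>
    upstream_demand V rhoj UL = flux V (ustar V rhoj UL)"
proof -
  interpret lwr V rhoj using assms by unfold_locales
  note UL = assms(6) and UR = assms(7)
  have unique: "profile V rhoj UL ws \<xi> = profile V rhoj UL ws' \<xi>"
    if "entropy_waves V rhoj UL UR ws" "entropy_waves V rhoj UL UR ws'" for ws ws' \<xi>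
    using profile_unique[OF that UL UR] .
  show ?thesis
  proof (intro conjI allI impI)
    obtain ws where "entropy_waves V rhoj UL UR ws" using entropy_waves_exist[OF UL UR] by blast
    then have "wave_solution V rhoj UL UR ws
        (\<lambda>x t. if 0 < t then profile V rhoj UL ws (x / t) else if x < 0 then UL else UR)"
      by (simp add: wave_solution_def)
    then show "\<exists>W. riemann_solution V rhoj UL UR W" unfolding riemann_solution_def by blast
  next
    fix W W' x and t :: real
    assume "riemann_solution V rhoj UL UR W \<and> riemann_solution V rhoj UL UR W'" "0 < t"
    then show "W x t = W' x t"
      unfolding riemann_solution_def wave_solution_def using unique by metis
  next
    fix W T assume *: "riemann_solution V rhoj UL UR W \<and> type_cond V rhoj T UL UR"
    then obtain ws where ws: "type_waves V rhoj T UL UR ws" "entropy_waves V rhoj UL UR (proper ws)"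
      using type_realized[OF UL UR] unfolding realizes_def by blast
    then have "wave_solution V rhoj UL UR (proper ws) W"
      using * unique unfolding riemann_solution_def wave_solution_def by metis
    with ws show "\<exists>ws. type_waves V rhoj T UL UR ws \<and> wave_solution V rhoj UL UR (proper ws) W"
      by blast
  qed (use type_unique[OF UL UR] boundary_flux_eq[OF UL UR] type_flux_eq[OF UL UR]
      ustar_flux[OF UL UR] in auto)
qed

end
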